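(* Let $G=(V,E)$ be the king grid and let $S\subset V$ be a locating-paired-dominating set of $G$. Fix any perfect matching $M$ of the induced subgraph $G[S]$, and for $v\in S$ let $m(v)$ denote the partner of $v$ in $M$. Define $S_1=\{v\in S : |N(v)\cap N(m(v))|=2\}$ and $S_2=\{v\in S : |N(v)\cap N(m(v))|=4\}$. Then $$\frac{9}{2}D(S_1)+5D(S_2)\ge 1.$$
   Context: The king grid is the infinite graph with vertex set $\mathbb{Z}\times\mathbb{Z}$ in which two distinct vertices are adjacent iff their Euclidean distance is at most $\sqrt2$. $N(v)$ is the open neighborhood of $v$ and $N[v]=N(v)\cup\{v\}$. A set $S\subset V$ is a locating-paired-dominating set (LPDS) if (i) every vertex $v\in V$ satisfies $N[v]\cap S\neq\emptyset$, (ii) the induced subgraph $G[S]$ has a perfect matching, and (iii) for any two distinct vertices $u,v\in V\setminus S$, $N(u)\cap S\neq N(v)\cap S$. For $k\ge 0$ and $u\in V$, $N^k[u]=\{x\in V: d(u,x)\le k\}$, where $d$ is graph distance. The density of a set $A\subset V$ is $D(A)=\limsup_{k\to\infty}\frac{|A\cap N^k[u]|}{|N^k[u]|}$ (independent of the choice of $u$). *)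

theory Defs
  imports Complex_Main "HOL-Library.Extended_Real" "HOL-Library.Liminf_Limsup"
begin

type_synonym vtx = "int \<times> int"

definition king_adj :: "vtx \<Rightarrow> vtx \<Rightarrow> bool" where
  "king_adj u v \<longleftrightarrow> u \<noteq> v \<and>
     (real_of_int (fst u - fst v))\<^sup>2 + (real_of_int (snd u - snd v))\<^sup>2 \<le> 2"

definition nbh :: "vtx \<Rightarrow> vtx set" where
  "nbh v = {w. king_adj v w}"

definition cnbh :: "vtx \<Rightarrow> vtx set" where
  "cnbh v = insert v (nbh v)"

definition perfect_matching :: "vtx set \<Rightarrow> vtx set set \<Rightarrow> bool" where
  "perfect_matching S M \<longleftrightarrow>
     M \<subseteq> {{a, b} | a b. a \<in> S \<and> b \<in> S \<and> king_adj a b} \<and>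
     (\<forall>v\<in>S. \<exists>!e. e \<in> M \<and> v \<in> e)"

definition partner :: "vtx set set \<Rightarrow> vtx \<Rightarrow> vtx" where
  "partner M v = (THE w. {v, w} \<in> M \<and> w \<noteq> v)"

definition is_LPDS :: "vtx set \<Rightarrow> bool" where
  "is_LPDS S \<longleftrightarrow>
     (\<forall>v. cnbh v \<inter> S \<noteq> {}) \<and>
     (\<exists>M. perfect_matching S M) \<and>
     (\<forall>u v. u \<notin> S \<longrightarrow> v \<notin> S \<longrightarrow> u \<noteq> v \<longrightarrow> nbh u \<inter> S \<noteq> nbh v \<inter> S)"

definition ball_k :: "nat \<Rightarrow> vtx \<Rightarrow> vtx set" where
  "ball_k k u = {x. (u, x) \<in> ({(a, b). king_adj a b} \<union> Id) ^^ k}"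

definition density :: "vtx set \<Rightarrow> ereal" where
  "density A = limsup (\<lambda>k. ereal (real (card (A \<inter> ball_k k (0, 0))) /
                                  real (card (ball_k k (0, 0)))))"

end

theory Submission
  imports Defs
begin

text \<open>
  Let \<open>c u\<close> be the number of vertices of \<open>S\<close> in \<open>N[u]\<close>. Summing
  \<open>2 + max 0 (c u - 2) = c u + [c u = 1]\<close> over a large box \<open>B\<close>, and using that \<open>c\<close> sums to
  about \<open>9 |S \<inter> B|\<close> and that distinct vertices with \<open>c u = 1\<close> see distinct elements of \<open>S\<close>, gives
  up to boundary terms \<open>2 |B| + W \<le> 10 |S \<inter> B|\<close>, where \<open>W\<close> counts \<open>c u - 2\<close> slots at every \<open>u\<close>
  with \<open>c u \<ge> 3\<close> and one slot for every element of \<open>S\<close> that is not the only neighbour in \<open>S\<close> of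
  some vertex outside \<open>S\<close>. It therefore suffices to give each \<open>s\<close> in a diagonal pair (these form \<open>S\<^sub>1\<close>)
  its own slot in \<open>N[s]\<close>.

  An \<open>s\<close> adjacent to more than its partner, or without a private vertex, has a slot of its own.
  Otherwise \<open>s\<close> takes a slot at a neighbour \<open>u\<close> which sees two adjacent elements of \<open>S\<close>, provided \<open>s\<close> is
  not in a component of size two of \<open>S \<inter> N(u)\<close>. If there is no such \<open>u\<close>, a case analysis
  of the ring around \<open>s\<close> shows that \<open>s\<close> can take the slot of a neighbour \<open>u\<close> that sees three pairwise
  nonadjacent elements of \<open>S\<close>, or, in one symmetric configuration, of a common neighbour of \<open>s\<close> and
  its partner.
\<close>

section \<open>The king grid\<close>

text \<open>An integer square above 1 is at least 4, so a squared distance of at most 2 bounds each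
  coordinate separately.\<close>

lemma king_adj_iff:
  "king_adj u v \<longleftrightarrow> u \<noteq> v \<and> \<bar>fst u - fst v\<bar> \<le> 1 \<and> \<bar>snd u - snd v\<bar> \<le> 1"
proof -
  have bound: "x\<^sup>2 + y\<^sup>2 \<le> 2 \<longleftrightarrow> \<bar>x\<bar> \<le> 1 \<and> \<bar>y\<bar> \<le> 1" for x y :: int
  proof
    assume le: "x\<^sup>2 + y\<^sup>2 \<le> 2"
    have aux: "\<bar>z\<bar> \<le> 1" if "z\<^sup>2 \<le> 2" for z :: int
    proof (rule ccontr)
      assume "\<not> \<bar>z\<bar> \<le> 1"
      then have "2\<^sup>2 \<le> \<bar>z\<bar>\<^sup>2" by (intro power_mono) auto
      then show False using that by simp
    qed
    show "\<bar>x\<bar> \<le> 1 \<and> \<bar>y\<bar> \<le> 1"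
      using aux[of x] aux[of y] le zero_le_power2[of x] zero_le_power2[of y] by linarith
  next
    assume "\<bar>x\<bar> \<le> 1 \<and> \<bar>y\<bar> \<le> 1"
    then have "x = -1 \<or> x = 0 \<or> x = 1" "y = -1 \<or> y = 0 \<or> y = 1" by linarith+
    then show "x\<^sup>2 + y\<^sup>2 \<le> 2" by auto
  qed
  have "(real_of_int x)\<^sup>2 + (real_of_int y)\<^sup>2 \<le> 2 \<longleftrightarrow> x\<^sup>2 + y\<^sup>2 \<le> 2" for x y :: int
    by (metis (mono_tags, opaque_lifting) of_int_add of_int_le_numeral_iff of_int_power)
  then show ?thesis unfolding king_adj_def using bound by (simp del: of_int_diff)
qed

lemma king_adj_sym: "king_adj u v \<longleftrightarrow> king_adj v u"
  by (auto simp: king_adj_iff abs_minus_commute)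

lemma in_nbh_iff: "v \<in> nbh u \<longleftrightarrow> king_adj u v"
  by (simp add: nbh_def)

lemma cnbh_eq: "cnbh v = {fst v - 1..fst v + 1} \<times> {snd v - 1..snd v + 1}"
  by (cases v) (auto simp: cnbh_def nbh_def king_adj_iff)

lemma finite_cnbh [simp]: "finite (cnbh v)"
  by (simp add: cnbh_eq)

lemma card_cnbh: "card (cnbh v) = 9"
  by (simp add: cnbh_eq card_cartesian_product)

lemma finite_nbh [simp]: "finite (nbh v)"
  using finite_cnbh[of v] by (simp add: cnbh_def)

lemma self_notin_nbh [simp]: "v \<notin> nbh v"
  by (simp add: in_nbh_iff king_adj_iff)

lemma in_cnbh_sym: "u \<in> cnbh v \<longleftrightarrow> v \<in> cnbh u"
  by (auto simp: cnbh_def in_nbh_iff king_adj_sym)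

definition line :: "vtx \<Rightarrow> vtx \<Rightarrow> bool" where
  "line u v \<longleftrightarrow> fst u = fst v \<or> snd u = snd v"

text \<open>The graph-distance ball of radius \<open>k\<close> about the origin; empty for negative
  \<open>k\<close>.\<close>

definition box :: "int \<Rightarrow> vtx set" where
  "box k = {- k..k} \<times> {- k..k}"

lemma finite_box [simp]: "finite (box k)"
  by (simp add: box_def)

lemma card_box: "card (box (int k)) = (2 * k + 1)\<^sup>2"
  by (simp add: box_def card_cartesian_product power2_eq_square nat_add_distrib nat_mult_distrib)

lemma cnbh_subset_box: "v \<in> box k \<Longrightarrow> cnbh v \<subseteq> box (k + 1)"
  by (auto simp: box_def cnbh_eq)

lemma ball_k_eq_box: "ball_k k (0, 0) = box (int k)"
proof (induction k)
  case 0
  show ?case by (auto simp: ball_k_def box_def)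
next
  case (Suc k)
  have step: "x \<in> ball_k (Suc k) (0, 0) \<longleftrightarrow> (\<exists>y \<in> ball_k k (0, 0). x \<in> cnbh y)" for x
    by (auto simp: ball_k_def cnbh_def in_nbh_iff relcomp_unfold)
  have "x \<in> box (int (Suc k)) \<longleftrightarrow> (\<exists>y \<in> box (int k). x \<in> cnbh y)" for x
  proof
    assume x: "x \<in> box (int (Suc k))"
    \<comment> \<open>One king move towards the origin shrinks both nonzero coordinates at
      once.\<close>
    have "(fst x - sgn (fst x), snd x - sgn (snd x)) \<in> box (int k)"
      using x by (cases x) (auto simp: box_def sgn_if)
    moreover have "x \<in> cnbh (fst x - sgn (fst x), snd x - sgn (snd x))"
      by (cases x) (auto simp: cnbh_eq sgn_if)
    ultimately show "\<exists>y \<in> box (int k). x \<in> cnbh y" by blast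
  next
    assume "\<exists>y \<in> box (int k). x \<in> cnbh y"
    then show "x \<in> box (int (Suc k))" using cnbh_subset_box[of _ "int k"] by (auto simp: add.commute)
  qed
  then show ?case using step Suc by blast
qed

section \<open>Frames\<close>

text \<open>\<open>fr s h k\<close> is the coordinate system with origin \<open>s\<close> and axes \<open>h\<close>, \<open>k\<close>; the eight frames at \<open>s\<close>
  carry the symmetries of the grid.\<close>

definition fr :: "vtx \<Rightarrow> vtx \<Rightarrow> vtx \<Rightarrow> int \<Rightarrow> int \<Rightarrow> vtx" where
  "fr s h k i j = (fst s + i * fst h + j * fst k, snd s + i * snd h + j * snd k)"

definition is_frame :: "vtx \<Rightarrow> vtx \<Rightarrow> bool" where
  "is_frame h k \<longleftrightarrow> (\<exists>e d. \<bar>e\<bar> = 1 \<and> \<bar>d\<bar> = 1 \<and>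
     (h = (e, 0) \<and> k = (0, d) \<or> h = (0, e) \<and> k = (d, 0)))"

lemma is_frame_cases:
  assumes "is_frame h k"
  obtains "h = (1, 0)" "k = (0, 1)" | "h = (1, 0)" "k = (0, -1)"
    | "h = (-1, 0)" "k = (0, 1)" | "h = (-1, 0)" "k = (0, -1)"
    | "h = (0, 1)" "k = (1, 0)" | "h = (0, 1)" "k = (-1, 0)"
    | "h = (0, -1)" "k = (1, 0)" | "h = (0, -1)" "k = (-1, 0)"
proof -
  obtain e d where ed: "\<bar>e\<bar> = 1" "\<bar>d\<bar> = 1"
    and hk: "h = (e, 0) \<and> k = (0, d) \<or> h = (0, e) \<and> k = (d, 0)"
    using assms unfolding is_frame_def by blast
  have e: "e = 1 \<or> e = -1" using ed(1) by linarith
  have d: "d = 1 \<or> d = -1" using ed(2) by linarith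
  show ?thesis using hk
  proof
    assume "h = (e, 0) \<and> k = (0, d)"
    then show ?thesis using e d that(1-4) by blast
  next
    assume "h = (0, e) \<and> k = (d, 0)"
    then show ?thesis using e d that(5-8) by blast
  qed
qed

lemma is_frame_swap: "is_frame h k \<Longrightarrow> is_frame k h"
  by (auto simp: is_frame_def)

lemma fr_swap: "fr s k h j i = fr s h k i j"
  by (simp add: fr_def)

lemma fr_0_0: "fr s h k 0 0 = s"
  by (simp add: fr_def)

lemma fr_eq_iff: "is_frame h k \<Longrightarrow> fr s h k i j = fr s h k a b \<longleftrightarrow> i = a \<and> j = b"
  by (erule is_frame_cases) (auto simp: fr_def)

lemma fr_adj_iff:
  "is_frame h k \<Longrightarrow> king_adj (fr s h k i j) (fr s h k a b) \<longleftrightarrow>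
     \<not> (i = a \<and> j = b) \<and> \<bar>i - a\<bar> \<le> 1 \<and> \<bar>j - b\<bar> \<le> 1"
  by (erule is_frame_cases) (auto simp: fr_def king_adj_iff)

lemma fr_line_iff: "is_frame h k \<Longrightarrow> line (fr s h k i j) (fr s h k a b) \<longleftrightarrow> i = a \<or> j = b"
  by (erule is_frame_cases) (auto simp: fr_def line_def)

lemma fr_surj:
  assumes "is_frame h k"
  obtains i j where "v = fr s h k i j"
proof -
  have "\<exists>i j. v = fr s h k i j"
    using assms
  proof (cases rule: is_frame_cases)
    case 1 then show ?thesis by (intro exI[of _ "fst v - fst s"] exI[of _ "snd v - snd s"]) (simp add: fr_def)
  next
    case 2 then show ?thesis by (intro exI[of _ "fst v - fst s"] exI[of _ "snd s - snd v"]) (simp add: fr_def)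
  next
    case 3 then show ?thesis by (intro exI[of _ "fst s - fst v"] exI[of _ "snd v - snd s"]) (simp add: fr_def)
  next
    case 4 then show ?thesis by (intro exI[of _ "fst s - fst v"] exI[of _ "snd s - snd v"]) (simp add: fr_def)
  next
    case 5 then show ?thesis by (intro exI[of _ "snd v - snd s"] exI[of _ "fst v - fst s"]) (simp add: fr_def)
  next
    case 6 then show ?thesis by (intro exI[of _ "snd v - snd s"] exI[of _ "fst s - fst v"]) (simp add: fr_def)
  next
    case 7 then show ?thesis by (intro exI[of _ "snd s - snd v"] exI[of _ "fst v - fst s"]) (simp add: fr_def)
  next
    case 8 then show ?thesis by (intro exI[of _ "snd s - snd v"] exI[of _ "fst s - fst v"]) (simp add: fr_def)
  qed
  then show ?thesis using that by blast
qed

lemma nbh_fr: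
  assumes "is_frame h k"
  shows "nbh (fr s h k i j) =
    {fr s h k (i - 1) (j - 1), fr s h k (i - 1) j, fr s h k (i - 1) (j + 1),
     fr s h k i (j - 1), fr s h k i (j + 1),
     fr s h k (i + 1) (j - 1), fr s h k (i + 1) j, fr s h k (i + 1) (j + 1)}" (is "?L = ?R")
proof
  show "?R \<subseteq> ?L" using assms by (auto simp: in_nbh_iff fr_adj_iff)
  show "?L \<subseteq> ?R"
  proof
    fix v assume v: "v \<in> ?L"
    obtain a b where ab: "v = fr s h k a b" using fr_surj[OF assms] by blast
    with v assms have "\<not> (i = a \<and> j = b)" "\<bar>i - a\<bar> \<le> 1" "\<bar>j - b\<bar> \<le> 1"
      by (auto simp: in_nbh_iff fr_adj_iff)
    then have "a = i - 1 \<or> a = i \<or> a = i + 1" "b = j - 1 \<or> b = j \<or> b = j + 1" "\<not> (i = a \<and> j = b)"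
      by linarith+
    then show "v \<in> ?R" unfolding ab by auto
  qed
qed

lemma diagonal_frame:
  assumes "king_adj s t" "\<not> line s t"
  obtains h k where "is_frame h k" "t = fr s h k 1 1"
proof
  show "is_frame (fst t - fst s, 0) (0, snd t - snd s)"
    using assms unfolding is_frame_def king_adj_iff line_def
    by (intro exI[of _ "fst t - fst s"] exI[of _ "snd t - snd s"]) auto
qed (simp add: fr_def)

lemma line_frame:
  assumes "king_adj s t" "line s t"
  obtains h k where "is_frame h k" "t = fr s h k 1 0"
proof (cases "fst s = fst t")
  case True
  show ?thesis
  proof
    show "is_frame (0, snd t - snd s) (1, 0)"
      using assms True unfolding is_frame_def king_adj_iff
      by (intro exI[of _ "snd t - snd s"] exI[of _ 1]) (auto simp: prod_eq_iff)
  qed (simp add: fr_def True)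
next
  case False
  show ?thesis
  proof
    show "is_frame (fst t - fst s, 0) (0, 1)"
      using assms False unfolding is_frame_def king_adj_iff
      by (intro exI[of _ "fst t - fst s"] exI[of _ 1]) auto
  qed (use assms False in \<open>simp add: fr_def line_def\<close>)
qed

text \<open>Tells diagonal from orthogonal pairs, which identifies the two classes of the
  theorem.\<close>

lemma card_common_nbh:
  assumes "king_adj v w"
  shows "card (nbh v \<inter> nbh w) = (if line v w then 4 else 2)"
proof (cases "line v w")
  case True
  then obtain h k where f: "is_frame h k" and w: "w = fr v h k 1 0"
    using line_frame assms by blast
  have "nbh (fr v h k 0 0) \<inter> nbh w = {fr v h k 0 (-1), fr v h k 0 1, fr v h k 1 (-1), fr v h k 1 1}"
    unfolding w nbh_fr[OF f] by (auto simp: fr_eq_iff[OF f])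
  then show ?thesis using True by (simp add: fr_eq_iff[OF f] fr_0_0)
next
  case False
  then obtain h k where f: "is_frame h k" and w: "w = fr v h k 1 1"
    using diagonal_frame assms by blast
  have "nbh (fr v h k 0 0) \<inter> nbh w = {fr v h k 0 1, fr v h k 1 0}"
    unfolding w nbh_fr[OF f] by (auto simp: fr_eq_iff[OF f])
  then show ?thesis using False by (simp add: fr_eq_iff[OF f] fr_0_0)
qed

declare split_paired_All [simp del] split_paired_Ex [simp del]

section \<open>Slots\<close>

lemma Int_insert_Un: "insert a B \<inter> C = (if a \<in> C then {a} else {}) \<union> (B \<inter> C)"
  by auto

text \<open>The matching enters only through the involution \<open>m\<close>.\<close>

locale lpds =
  fixes S :: "vtx set" and m :: "vtx \<Rightarrow> vtx"
  assumes dominating: "cnbh v \<inter> S \<noteq> {}"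
    and m_in: "v \<in> S \<Longrightarrow> m v \<in> S"
    and m_adj: "v \<in> S \<Longrightarrow> king_adj v (m v)"
    and m_m: "v \<in> S \<Longrightarrow> m (m v) = v"
    and locating: "u \<notin> S \<Longrightarrow> v \<notin> S \<Longrightarrow> nbh u \<inter> S = nbh v \<inter> S \<Longrightarrow> u = v"
begin

text \<open>Elements of \<open>S\<close> have \<open>c u \<ge> 2\<close> because of their partners,
  so the vertices with \<open>c u = 1\<close> are exactly such \<open>u\<close>.\<close>

definition has_private :: "vtx \<Rightarrow> bool" where
  "has_private s \<longleftrightarrow> (\<exists>u. u \<notin> S \<and> nbh u \<inter> S = {s})"

definition diagonal :: "vtx \<Rightarrow> bool" where
  "diagonal s \<longleftrightarrow> s \<in> S \<and> \<not> line s (m s)"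

definition needy :: "vtx \<Rightarrow> bool" where
  "needy s \<longleftrightarrow> diagonal s \<and> nbh s \<inter> S = {m s} \<and> has_private s"

definition rich :: "vtx \<Rightarrow> bool" where
  "rich u \<longleftrightarrow> u \<notin> S \<and> (\<exists>x \<in> nbh u \<inter> S. \<exists>y \<in> nbh u \<inter> S. king_adj x y)"

text \<open>The three seen elements are pairwise nonadjacent, and \<open>u\<close> has a single slot
  to give.\<close>

definition poor :: "vtx \<Rightarrow> bool" where
  "poor u \<longleftrightarrow> u \<notin> S \<and> \<not> rich u \<and> card (nbh u \<inter> S) = 3"

text \<open>The second condition says that \<open>{s, m s}\<close> is not a component of \<open>S \<inter> N(u)\<close>: when \<open>s\<close> has
  no other neighbour in \<open>S\<close>, its component is either \<open>{s}\<close> or has at least three elements.\<close>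

definition feeds :: "vtx \<Rightarrow> vtx \<Rightarrow> bool" where
  "feeds u s \<longleftrightarrow> rich u \<and> u \<in> nbh s \<and>
     (m s \<notin> nbh u \<or> (\<exists>z \<in> nbh u \<inter> S. z \<noteq> s \<and> king_adj z (m s)))"

definition unfed :: "vtx \<Rightarrow> bool" where
  "unfed s \<longleftrightarrow> needy s \<and> (\<forall>u. \<not> feeds u s)"

definition side_claim :: "vtx \<Rightarrow> vtx \<Rightarrow> bool" where
  "side_claim s u \<longleftrightarrow> unfed s \<and> poor u \<and> s \<in> nbh u \<and> line s u"

definition lone_claim :: "vtx \<Rightarrow> vtx \<Rightarrow> bool" where
  "lone_claim s u \<longleftrightarrow> unfed s \<and> poor u \<and> s \<in> nbh u \<and> (\<forall>t \<in> nbh u \<inter> S. t \<noteq> s \<longrightarrow> \<not> unfed t)"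

text \<open>The remaining conflict: \<open>s = (0,0)\<close> and \<open>(0,-2)\<close> are both unfed and see \<open>(1,-1)\<close>. The third
  element \<open>(2,-1)\<close> of \<open>S\<close> seen by \<open>(1,-1)\<close> is fed by \<open>(1,0)\<close>. If the configuration is symmetric
  about the axis through \<open>(1,-1)\<close> and \<open>(2,-1)\<close>, then \<open>(2,-1)\<close> is fed by \<open>(1,-2)\<close> too; it
  keeps the one opposite to its partner and the other is free.\<close>

definition twin :: "vtx \<Rightarrow> vtx \<Rightarrow> vtx \<Rightarrow> bool" where
  "twin s h k \<longleftrightarrow> is_frame h k \<and> m s = fr s h k 1 1 \<and> unfed s \<and> unfed (fr s h k 0 (-2)) \<and>
     poor (fr s h k 1 (-1)) \<and>
     nbh (fr s h k 1 (-1)) \<inter> S = {fr s h k 0 0, fr s h k 0 (-2), fr s h k 2 (-1)}"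

text \<open>The element \<open>(0,-2)\<close> is in the mirrored position only if its partner is
  \<open>(1,-3)\<close>. The partner of \<open>(2,-1)\<close> then breaks the tie, as
  \<open>(3,-2)\<close> becomes \<open>(3,0)\<close> in the mirrored frame.\<close>

definition end_claim :: "vtx \<Rightarrow> vtx \<Rightarrow> bool" where
  "end_claim s u \<longleftrightarrow> (\<exists>h k. twin s h k \<and> u = fr s h k 1 (-1) \<and>
     (m (fr s h k 0 (-2)) = fr s h k (-1) (-3) \<or>
      m (fr s h k 0 (-2)) = fr s h k 1 (-3) \<and> m (fr s h k 2 (-1)) = fr s h k 3 (-2)))"

text \<open>Here the partner of \<open>(2,-1)\<close> is \<open>(3,-1)\<close>, and
  \<open>(2,-1)\<close> takes no slot, or \<open>(3,0)\<close>, and it takes none but the opposite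
  vertex \<open>(1,-2)\<close>. Either way \<open>(1,0)\<close> is free.\<close>

definition common_claim :: "vtx \<Rightarrow> vtx \<Rightarrow> bool" where
  "common_claim s u \<longleftrightarrow> (\<exists>h k. twin s h k \<and> u = fr s h k 1 0 \<and>
     m (fr s h k 0 (-2)) = fr s h k 1 (-3) \<and> m (fr s h k 2 (-1)) \<noteq> fr s h k 3 (-2))"

definition opposite :: "vtx \<Rightarrow> vtx" where
  "opposite s = (2 * fst s - fst (m s), 2 * snd s - snd (m s))"

text \<open>Preferring \<open>opposite s\<close>, the reflection of \<open>m s\<close> in
  \<open>s\<close>, makes the choice among several feeding vertices predictable, on which
  \<open>common_claim\<close> relies.\<close>

definition slot :: "vtx \<Rightarrow> vtx" where
  "slot s =
    (if nbh s \<inter> S \<noteq> {m s} then s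
     else if feeds (opposite s) s then opposite s
     else if \<exists>u. feeds u s then SOME u. feeds u s
     else SOME u. side_claim s u \<or> lone_claim s u \<or> end_claim s u \<or> common_claim s u)"

lemma unfed_D:
  assumes "unfed s"
  shows "s \<in> S" "m s \<in> S" "\<not> line s (m s)" "nbh s \<inter> S = {m s}" "has_private s"
  using assms by (auto simp: unfed_def needy_def diagonal_def m_in)

lemma needy_nbr:
  assumes "needy s" "z \<in> S" "king_adj z s"
  shows "z = m s"
proof -
  have "z \<in> nbh s \<inter> S" using assms by (simp add: in_nbh_iff king_adj_sym)
  then show ?thesis using assms(1) unfolding needy_def by blast
qed

text \<open>Two elements seen by \<open>u\<close> always take nothing there: an adjacent pair if
  neither is fed, otherwise the partner \<open>y\<close> of the fed one and a further seen neighbour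
  \<open>z\<close> of \<open>y\<close>.\<close>

lemma card_fed_le:
  assumes "rich u"
  shows "card {s. needy s \<and> feeds u s} + 2 \<le> card (nbh u \<inter> S)"
proof -
  let ?D = "nbh u \<inter> S" and ?K = "{s. needy s \<and> feeds u s}"
  have KD: "?K \<subseteq> ?D"
    by (auto simp: needy_def diagonal_def feeds_def in_nbh_iff king_adj_sym)
  obtain x y where xy: "x \<in> ?D" "y \<in> ?D" "king_adj x y"
    using assms unfolding rich_def by blast
  have partner_unfed: "\<exists>z. z \<in> ?D - ?K \<and> y \<in> ?D - ?K \<and> z \<noteq> y"
    if xy: "x \<in> ?K" "x \<in> ?D" "y \<in> ?D" "king_adj x y" for x y
  proof -
    have "y = m x" using that needy_nbr[of x y] by (simp add: king_adj_sym)
    then obtain z where z: "z \<in> ?D" "z \<noteq> x" "king_adj z y"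
      using xy(1,3) unfolding feeds_def by blast
    \<comment> \<open>\<open>y\<close> has the two neighbours \<open>x\<close> and \<open>z\<close>
      in \<open>S\<close>, while \<open>z\<close> has the neighbour \<open>y\<close>, which is
      matched to \<open>x\<close>.\<close>
    have "\<not> needy y"
      using z that needy_nbr[of y x] needy_nbr[of y z] by auto
    moreover have "\<not> needy z"
    proof
      assume "needy z"
      then have "y = m z" using needy_nbr[of z y] z that by (simp add: king_adj_sym)
      then have "m y = z" using m_m[of z] z by simp
      moreover have "m y = x" using \<open>y = m x\<close> m_m[of x] that by simp
      ultimately show False using z by simp
    qed
    moreover have "z \<noteq> y" using z by (simp add: king_adj_iff)
    ultimately show ?thesis using z that by blast
  qed
  have "\<exists>p q. p \<in> ?D - ?K \<and> q \<in> ?D - ?K \<and> p \<noteq> q"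
  proof -
    have "king_adj y x" "x \<noteq> y" using xy(3) king_adj_sym by (auto simp: king_adj_iff)
    consider "x \<in> ?K" | "y \<in> ?K" | "x \<notin> ?K" "y \<notin> ?K" by blast
    then show ?thesis
    proof cases
      case 1
      from partner_unfed[OF this xy] show ?thesis by blast
    next
      case 2
      from partner_unfed[OF this xy(2,1) \<open>king_adj y x\<close>] show ?thesis by blast
    next
      case 3
      then show ?thesis using xy(1,2) \<open>x \<noteq> y\<close> by blast
    qed
  qed
  then obtain p q where pq: "p \<in> ?D - ?K" "q \<in> ?D - ?K" "p \<noteq> q" by blast
  have "card {p, q} \<le> card (?D - ?K)" using pq by (intro card_mono) auto
  then have "2 \<le> card ?D - card ?K" using pq KD by (simp add: card_Diff_subset finite_subset[OF KD])
  then show ?thesis by linarith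
qed

section \<open>Counting coverage over a box\<close>

lemma sum_coverage_le:
  "(\<Sum>u \<in> box k. card (cnbh u \<inter> S)) \<le> 9 * card (S \<inter> box (k + 1))"
proof -
  let ?T = "S \<inter> box (k + 1)"
  have "card (cnbh u \<inter> S) = (\<Sum>s \<in> ?T. of_bool (s \<in> cnbh u))" if "u \<in> box k" for u
  proof -
    have "cnbh u \<inter> S = {s \<in> ?T. s \<in> cnbh u}" using cnbh_subset_box[OF that] by auto
    then show ?thesis by (simp add: Int_def)
  qed
  then have "(\<Sum>u \<in> box k. card (cnbh u \<inter> S)) = (\<Sum>u \<in> box k. \<Sum>s \<in> ?T. of_bool (s \<in> cnbh u))"
    by simp
  also have "\<dots> = (\<Sum>s \<in> ?T. \<Sum>u \<in> box k. of_bool (s \<in> cnbh u))" by (rule sum.swap)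
  also have "\<dots> \<le> (\<Sum>s \<in> ?T. 9)"
  proof (rule sum_mono)
    fix s
    have "(\<Sum>u \<in> box k. of_bool (s \<in> cnbh u)) = card {u \<in> box k. s \<in> cnbh u}"
      by (simp add: Int_def)
    also have "\<dots> \<le> card (cnbh s)" by (intro card_mono) (auto simp: in_cnbh_sym)
    finally show "(\<Sum>u \<in> box k. of_bool (s \<in> cnbh u)) \<le> (9::nat)" by (simp add: card_cnbh)
  qed
  finally show ?thesis by simp
qed

lemma cnbh_Int_notin: "u \<notin> S \<Longrightarrow> cnbh u \<inter> S = nbh u \<inter> S"
  by (auto simp: cnbh_def)

lemma card_cnbh_pos: "card (cnbh u \<inter> S) \<ge> 1"
  using dominating[of u] by (simp add: Suc_le_eq card_gt_0_iff)

lemma two_le_card_cnbh: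
  assumes "u \<in> S"
  shows "2 \<le> card (cnbh u \<inter> S)"
proof -
  have "card {u, m u} \<le> card (cnbh u \<inter> S)"
    using assms m_in m_adj[OF assms] by (intro card_mono) (auto simp: cnbh_def in_nbh_iff)
  then show ?thesis using m_adj[OF assms] by (simp add: king_adj_iff split: if_splits)
qed

text \<open>By location, sending a singly covered vertex to the one element of \<open>S\<close> it
  sees is injective.\<close>

lemma card_singly_covered_le:
  "card {u \<in> box k. card (cnbh u \<inter> S) = 1} \<le> card {s \<in> S \<inter> box (k + 1). has_private s}"
proof -
  let ?P = "{u \<in> box k. card (cnbh u \<inter> S) = 1}"
  have ex: "\<exists>s. u \<notin> S \<and> nbh u \<inter> S = {s}" if "u \<in> ?P" for u
  proof -
    have "u \<notin> S" using two_le_card_cnbh[of u] that by auto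
    then show ?thesis using that by (auto simp: cnbh_Int_notin card_1_singleton_iff)
  qed
  define g where "g u = the_elem (nbh u \<inter> S)" for u
  have g: "u \<notin> S \<and> nbh u \<inter> S = {g u}" if u: "u \<in> ?P" for u
  proof -
    obtain s where "u \<notin> S" "nbh u \<inter> S = {s}" using ex[OF u] by blast
    then show ?thesis by (simp add: g_def)
  qed
  have "inj_on g ?P"
  proof (rule inj_onI)
    fix u v assume "u \<in> ?P" "v \<in> ?P" "g u = g v"
    then show "u = v" using g[of u] g[of v] locating[of u v] by simp
  qed
  moreover have "g ` ?P \<subseteq> {s \<in> S \<inter> box (k + 1). has_private s}"
  proof
    fix s assume "s \<in> g ` ?P"
    then obtain u where u: "u \<in> ?P" "s = g u" by blast
    then have "s \<in> nbh u" "s \<in> S" "has_private s"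
      using g[OF u(1)] unfolding has_private_def by blast+
    moreover have "s \<in> cnbh u" using \<open>s \<in> nbh u\<close> by (simp add: cnbh_def)
    ultimately show "s \<in> {s \<in> S \<inter> box (k + 1). has_private s}"
      using cnbh_subset_box[of u k] u(1) by auto
  qed
  ultimately show ?thesis by (intro card_inj_on_le) auto
qed

lemma not_unfed_if_nbr:
  assumes "t \<in> S" "z \<in> S" "king_adj z t" "z \<noteq> m t"
  shows "\<not> unfed t"
  using assms needy_nbr unfolding unfed_def by blast

lemma not_unfed_if_feeds: "feeds u t \<Longrightarrow> \<not> unfed t"
  by (auto simp: unfed_def)

end

section \<open>Unfed vertices\<close>

text \<open>The booleans \<open>a1\<close> to \<open>a11\<close> say which of the vertices
  \<open>(-1,2)\<close>, \<open>(-2,2)\<close>, \<open>(-2,1)\<close>, \<open>(-2,0)\<close>, \<open>(-2,-1)\<close>, \<open>(-2,-2)\<close>, \<open>(-1,-2)\<close>,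
  \<open>(0,-2)\<close>, \<open>(1,-2)\<close>, \<open>(2,-2)\<close>, \<open>(2,-1)\<close> lie in \<open>S\<close>, in a frame with
  \<open>s = (0,0)\<close> and \<open>m s = (1,1)\<close>.\<close>

lemma hub_cases:
  assumes nonadjacent: "\<not> (a1 \<and> a2)" "\<not> (a2 \<and> a3)" "\<not> (a3 \<and> a4)" "\<not> (a1 \<and> a3)" "\<not> (a4 \<and> a5)"
    "\<not> (a5 \<and> a6)" "\<not> (a6 \<and> a7)" "\<not> (a7 \<and> a8)" "\<not> (a5 \<and> a7)" "\<not> (a8 \<and> a9)"
    "\<not> (a9 \<and> a10)" "\<not> (a10 \<and> a11)" "\<not> (a9 \<and> a11)"
    and located: "a1 \<or> a2 \<or> a5" "a3 \<or> a6 \<or> a7 \<or> a8" "a4 \<or> a5 \<or> a6 \<or> a9" "a7 \<or> a10 \<or> a11"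
    "a1 \<or> a2 \<or> a3 \<or> a5 \<or> a6 \<or> a7 \<or> a8" "a3 \<or> a4 \<or> a5 \<or> a7 \<or> a8 \<or> a9"
    "a4 \<or> a5 \<or> a6 \<or> a7 \<or> a9 \<or> a10 \<or> a11"
    "a1 \<or> a2 \<or> a3 \<or> a4 \<or> a7 \<or> a8 \<or> a9" "a3 \<or> a4 \<or> a5 \<or> a8 \<or> a9 \<or> a10 \<or> a11"
    "a1 \<or> a2 \<or> a3 \<or> a4 \<or> a8 \<or> a9 \<or> a10 \<or> a11"
    and single: "\<not> (a1 \<or> a2 \<or> a3 \<or> a4) \<or> \<not> (a3 \<or> a4 \<or> a5) \<or> \<not> (a4 \<or> a5 \<or> a6 \<or> a7 \<or> a8) \<or>
      \<not> (a7 \<or> a8 \<or> a9) \<or> \<not> (a8 \<or> a9 \<or> a10 \<or> a11)"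
  shows "a3 \<and> a5 \<or> a7 \<and> a9 \<or>
    a8 \<and> \<not> a4 \<and> (a5 \<and> \<not> a6 \<or> a6 \<and> \<not> a5) \<and> (a10 \<and> \<not> a11 \<or> a11 \<and> \<not> a10) \<or>
    a4 \<and> \<not> a8 \<and> (a7 \<and> \<not> a6 \<or> a6 \<and> \<not> a7) \<and> (a2 \<and> \<not> a1 \<or> a1 \<and> \<not> a2)"
  using assms by satx

text \<open>Normal form of an unfed vertex. Exchanging the axes preserves it, so each result also
  holds in reflected form.\<close>

locale lpds_frame = lpds +
  fixes s h k
  assumes frame: "is_frame h k" and unfed_s: "unfed s" and m_s: "m s = fr s h k 1 1"
begin

abbreviation F :: "int \<Rightarrow> int \<Rightarrow> vtx" where "F \<equiv> fr s h k"

abbreviation q :: "int \<Rightarrow> int \<Rightarrow> bool" where "q i j \<equiv> F i j \<in> S"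

lemmas F_eq = fr_eq_iff[OF frame] and F_adj = fr_adj_iff[OF frame]
  and F_line = fr_line_iff[OF frame] and F_nbh = nbh_fr[OF frame]

lemma q_0_0: "q 0 0"
  using unfed_D(1)[OF unfed_s] by (simp add: fr_0_0)

lemma q_1_1: "q 1 1"
  using unfed_D(2)[OF unfed_s] by (simp add: m_s)

lemma m_0_0: "m (F 0 0) = F 1 1"
  using m_s by (simp add: fr_0_0)

lemma nbh_s: "nbh (F 0 0) \<inter> S = {F 1 1}"
  using unfed_D(4)[OF unfed_s] by (simp add: m_s fr_0_0)

section \<open>The ring of cells around an unfed vertex\<close>

lemma not_q_nbr:
  assumes "\<bar>i\<bar> \<le> 1" "\<bar>j\<bar> \<le> 1" "\<not> (i = 0 \<and> j = 0)" "\<not> (i = 1 \<and> j = 1)"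
  shows "\<not> q i j"
proof
  assume "q i j"
  then have "F i j \<in> nbh (F 0 0) \<inter> S" using assms by (auto simp: in_nbh_iff F_adj)
  then show False using assms nbh_s by (simp add: F_eq)
qed

lemma not_q:
  "\<not> q (-1) 1" "\<not> q (-1) 0" "\<not> q (-1) (-1)" "\<not> q 0 (-1)" "\<not> q 1 (-1)" "\<not> q 0 1" "\<not> q 1 0"
  by (simp_all add: not_q_nbr)

lemma not_feeds: "\<not> feeds u (F 0 0)"
  using unfed_s by (simp add: unfed_def fr_0_0)

text \<open>These five cells next to \<open>s\<close> do not see \<open>m s\<close>, so a rich one
  would feed \<open>s\<close>. Only they can be private vertices of \<open>s\<close>.\<close>

lemma not_rich_private:
  assumes "i = -1 \<and> \<bar>j\<bar> \<le> 1 \<or> j = -1 \<and> \<bar>i\<bar> \<le> 1"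
  shows "\<not> rich (F i j)"
proof
  assume "rich (F i j)"
  then have "feeds (F i j) (F 0 0)"
    using assms unfolding feeds_def by (auto simp: in_nbh_iff F_adj m_0_0)
  then show False by (simp add: not_feeds)
qed

lemma not_q_both:
  assumes "i = -1 \<and> \<bar>j\<bar> \<le> 1 \<or> j = -1 \<and> \<bar>i\<bar> \<le> 1"
    and "king_adj (F i j) (F a b)" "king_adj (F i j) (F c d)" "king_adj (F a b) (F c d)"
  shows "\<not> (q a b \<and> q c d)"
proof
  assume "q a b \<and> q c d"
  moreover have "F i j \<notin> S" using assms(1) by (intro not_q_nbr) auto
  moreover have "F a b \<in> nbh (F i j)" "F c d \<in> nbh (F i j)" using assms(2,3) by (simp_all add: in_nbh_iff)
  ultimately have "rich (F i j)" using assms(4) unfolding rich_def by blast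
  then show False using not_rich_private[OF assms(1)] by simp
qed

text \<open>A common neighbour of \<open>s\<close> and \<open>m s\<close> is rich already; a further
  seen element next to \<open>m s\<close> would make it feed \<open>s\<close>.\<close>

lemma not_q_common:
  assumes "i = 1 \<and> j = 0 \<or> i = 0 \<and> j = 1"
    and "king_adj (F i j) (F a b)" "king_adj (F a b) (F 1 1)" "\<not> (a = 0 \<and> b = 0)"
  shows "\<not> q a b"
proof
  assume q: "q a b"
  have "F i j \<notin> S" using assms(1) by (intro not_q_nbr) auto
  then have "rich (F i j)"
    using assms(1) q_0_0 q_1_1 unfolding rich_def
    by (intro conjI bexI[of _ "F 0 0"] bexI[of _ "F 1 1"]) (auto simp: in_nbh_iff F_adj)
  moreover have "F a b \<noteq> F 0 0" using assms(4) by (simp add: F_eq)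
  ultimately have "feeds (F i j) (F 0 0)"
    using assms q unfolding feeds_def m_0_0 by (auto simp: in_nbh_iff F_adj)
  then show False by (simp add: not_feeds)
qed

lemma not_q_common_simps: "\<not> q 2 0" "\<not> q 2 1" "\<not> q 0 2" "\<not> q 1 2"
proof -
  show "\<not> q 2 0" "\<not> q 2 1" by (rule not_q_common[of 1 0]; simp add: F_adj)+
  show "\<not> q 0 2" "\<not> q 1 2" by (rule not_q_common[of 0 1]; simp add: F_adj)+
qed

lemma locating_q: "F i j \<notin> S \<Longrightarrow> F a b \<notin> S \<Longrightarrow> \<not> (i = a \<and> j = b) \<Longrightarrow>
    nbh (F i j) \<inter> S \<noteq> nbh (F a b) \<inter> S"
  using locating[of "F i j" "F a b"] by (auto simp: F_eq)

text \<open>One disjunction for each pair of the five cells: it lists the ring cells seen by exactly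
  one of the two, without those known to be outside \<open>S\<close>.\<close>

lemma located:
  "q (-1) 2 \<or> q (-2) 2 \<or> q (-2) (-1)"
  "q (-2) 1 \<or> q (-2) (-2) \<or> q (-1) (-2) \<or> q 0 (-2)"
  "q (-2) 0 \<or> q (-2) (-1) \<or> q (-2) (-2) \<or> q 1 (-2)"
  "q (-1) (-2) \<or> q 2 (-2) \<or> q 2 (-1)"
  "q (-1) 2 \<or> q (-2) 2 \<or> q (-2) 1 \<or> q (-2) (-1) \<or> q (-2) (-2) \<or> q (-1) (-2) \<or> q 0 (-2)"
  "q (-2) 1 \<or> q (-2) 0 \<or> q (-2) (-1) \<or> q (-1) (-2) \<or> q 0 (-2) \<or> q 1 (-2)"
  "q (-2) 0 \<or> q (-2) (-1) \<or> q (-2) (-2) \<or> q (-1) (-2) \<or> q 1 (-2) \<or> q 2 (-2) \<or> q 2 (-1)"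
  "q (-1) 2 \<or> q (-2) 2 \<or> q (-2) 1 \<or> q (-2) 0 \<or> q (-1) (-2) \<or> q 0 (-2) \<or> q 1 (-2)"
  "q (-2) 1 \<or> q (-2) 0 \<or> q (-2) (-1) \<or> q 0 (-2) \<or> q 1 (-2) \<or> q 2 (-2) \<or> q 2 (-1)"
  "q (-1) 2 \<or> q (-2) 2 \<or> q (-2) 1 \<or> q (-2) 0 \<or> q 0 (-2) \<or> q 1 (-2) \<or> q 2 (-2) \<or> q 2 (-1)"
proof -
  note simps = F_nbh not_q not_q_common_simps q_0_0 Int_insert_Un
  show "q (-1) 2 \<or> q (-2) 2 \<or> q (-2) (-1)"
    using locating_q[OF not_q(1,2)] by (rule contrapos_np) (simp_all add: simps split del: if_split)
  show "q (-2) 1 \<or> q (-2) (-2) \<or> q (-1) (-2) \<or> q 0 (-2)"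
    using locating_q[OF not_q(2,3)] by (rule contrapos_np) (simp_all add: simps split del: if_split)
  show "q (-2) 0 \<or> q (-2) (-1) \<or> q (-2) (-2) \<or> q 1 (-2)"
    using locating_q[OF not_q(3,4)] by (rule contrapos_np) (simp_all add: simps split del: if_split)
  show "q (-1) (-2) \<or> q 2 (-2) \<or> q 2 (-1)"
    using locating_q[OF not_q(4,5)] by (rule contrapos_np) (simp_all add: simps split del: if_split)
  show "q (-1) 2 \<or> q (-2) 2 \<or> q (-2) 1 \<or> q (-2) (-1) \<or> q (-2) (-2) \<or> q (-1) (-2) \<or> q 0 (-2)"
    using locating_q[OF not_q(1,3)] by (rule contrapos_np) (simp_all add: simps split del: if_split)
  show "q (-2) 1 \<or> q (-2) 0 \<or> q (-2) (-1) \<or> q (-1) (-2) \<or> q 0 (-2) \<or> q 1 (-2)"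
    using locating_q[OF not_q(2,4)] by (rule contrapos_np) (simp_all add: simps split del: if_split)
  show "q (-2) 0 \<or> q (-2) (-1) \<or> q (-2) (-2) \<or> q (-1) (-2) \<or> q 1 (-2) \<or> q 2 (-2) \<or> q 2 (-1)"
    using locating_q[OF not_q(3,5)] by (rule contrapos_np) (simp_all add: simps split del: if_split)
  show "q (-1) 2 \<or> q (-2) 2 \<or> q (-2) 1 \<or> q (-2) 0 \<or> q (-1) (-2) \<or> q 0 (-2) \<or> q 1 (-2)"
    using locating_q[OF not_q(1,4)] by (rule contrapos_np) (simp_all add: simps split del: if_split)
  show "q (-2) 1 \<or> q (-2) 0 \<or> q (-2) (-1) \<or> q 0 (-2) \<or> q 1 (-2) \<or> q 2 (-2) \<or> q 2 (-1)"
    using locating_q[OF not_q(2,5)] by (rule contrapos_np) (simp_all add: simps split del: if_split)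
  show "q (-1) 2 \<or> q (-2) 2 \<or> q (-2) 1 \<or> q (-2) 0 \<or> q 0 (-2) \<or> q 1 (-2) \<or> q 2 (-2) \<or> q 2 (-1)"
    using locating_q[OF not_q(1,5)] by (rule contrapos_np) (simp_all add: simps split del: if_split)
qed

lemma private_q:
  "\<not> (q (-1) 2 \<or> q (-2) 2 \<or> q (-2) 1 \<or> q (-2) 0) \<or> \<not> (q (-2) 1 \<or> q (-2) 0 \<or> q (-2) (-1)) \<or>
   \<not> (q (-2) 0 \<or> q (-2) (-1) \<or> q (-2) (-2) \<or> q (-1) (-2) \<or> q 0 (-2)) \<or>
   \<not> (q (-1) (-2) \<or> q 0 (-2) \<or> q 1 (-2)) \<or> \<not> (q 0 (-2) \<or> q 1 (-2) \<or> q 2 (-2) \<or> q 2 (-1))"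
proof -
  obtain u where u: "u \<notin> S" "nbh u \<inter> S = {F 0 0}"
    using unfed_D(5)[OF unfed_s] unfolding has_private_def fr_0_0 by blast
  then have "F 0 0 \<in> nbh u" by blast
  then have "u \<in> nbh (F 0 0)" by (simp add: in_nbh_iff king_adj_sym)
  then have "u \<in> {F (-1) (-1), F (-1) 0, F (-1) 1, F 0 (-1), F 0 1, F 1 (-1), F 1 0, F 1 1}"
    by (simp add: F_nbh)
  moreover have none: "\<not> q a b" if "F a b \<in> nbh u" "\<not> (a = 0 \<and> b = 0)" for a b
  proof
    assume "q a b"
    then have "F a b = F 0 0" using u(2) that(1) by blast
    then show False using that(2) by (simp add: F_eq)
  qed
  \<comment> \<open>The private vertex is neither \<open>m s\<close>, which is in \<open>S\<close>,
    nor a common neighbour, which sees \<open>m s\<close>; each disjunct is one of the five other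
    cells.\<close>
  ultimately show ?thesis using u(1) q_1_1 none[of 1 1]
    none[of "-1" 2] none[of "-2" 2] none[of "-2" 1] none[of "-2" 0] none[of "-2" "-1"]
    none[of "-2" "-2"] none[of "-1" "-2"] none[of 0 "-2"] none[of 1 "-2"] none[of 2 "-2"] none[of 2 "-1"]
    by (elim insertE emptyE) (simp_all add: in_nbh_iff F_adj)
qed

text \<open>Each pair is adjacent and seen by one of the corners \<open>(-1,1)\<close>,
  \<open>(-1,-1)\<close>, \<open>(1,-1)\<close>, none of which is rich.\<close>

lemma nonadjacent:
  "\<not> (q (-1) 2 \<and> q (-2) 2)" "\<not> (q (-2) 2 \<and> q (-2) 1)" "\<not> (q (-2) 1 \<and> q (-2) 0)"
  "\<not> (q (-1) 2 \<and> q (-2) 1)" "\<not> (q (-2) 0 \<and> q (-2) (-1))" "\<not> (q (-2) (-1) \<and> q (-2) (-2))"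
  "\<not> (q (-2) (-2) \<and> q (-1) (-2))" "\<not> (q (-1) (-2) \<and> q 0 (-2))" "\<not> (q (-2) (-1) \<and> q (-1) (-2))"
  "\<not> (q 0 (-2) \<and> q 1 (-2))" "\<not> (q 1 (-2) \<and> q 2 (-2))" "\<not> (q 2 (-2) \<and> q 2 (-1))"
  "\<not> (q 1 (-2) \<and> q 2 (-1))"
proof -
  show "\<not> (q (-1) 2 \<and> q (-2) 2)" "\<not> (q (-2) 2 \<and> q (-2) 1)" "\<not> (q (-2) 1 \<and> q (-2) 0)"
    "\<not> (q (-1) 2 \<and> q (-2) 1)" by (rule not_q_both[of "-1" 1]; simp add: F_adj)+
  show "\<not> (q (-2) 0 \<and> q (-2) (-1))" "\<not> (q (-2) (-1) \<and> q (-2) (-2))"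
    "\<not> (q (-2) (-2) \<and> q (-1) (-2))" "\<not> (q (-1) (-2) \<and> q 0 (-2))" "\<not> (q (-2) (-1) \<and> q (-1) (-2))"
    by (rule not_q_both[of "-1" "-1"]; simp add: F_adj)+
  show "\<not> (q 0 (-2) \<and> q 1 (-2))" "\<not> (q 1 (-2) \<and> q 2 (-2))" "\<not> (q 2 (-2) \<and> q 2 (-1))"
    "\<not> (q 1 (-2) \<and> q 2 (-1))"
    by (rule not_q_both[of 1 "-1"]; simp add: F_adj)+
qed

text \<open>The first two alternatives serve a side claim at \<open>(-1,0)\<close> or
  \<open>(0,-1)\<close>. The other two mirror each other and have a hub, \<open>(0,-2)\<close> or
  \<open>(-2,0)\<close>, which two corner cells see together with \<open>s\<close>.\<close>

lemma frame_cases: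
  "q (-2) 1 \<and> q (-2) (-1) \<or> q (-1) (-2) \<and> q 1 (-2) \<or>
   q 0 (-2) \<and> \<not> q (-2) 0 \<and> (q (-2) (-1) \<and> \<not> q (-2) (-2) \<or> q (-2) (-2) \<and> \<not> q (-2) (-1)) \<and>
     (q 2 (-2) \<and> \<not> q 2 (-1) \<or> q 2 (-1) \<and> \<not> q 2 (-2)) \<or>
   q (-2) 0 \<and> \<not> q 0 (-2) \<and> (q (-1) (-2) \<and> \<not> q (-2) (-2) \<or> q (-2) (-2) \<and> \<not> q (-1) (-2)) \<and>
     (q (-2) 2 \<and> \<not> q (-1) 2 \<or> q (-1) 2 \<and> \<not> q (-2) 2)"
  by (rule hub_cases) (rule nonadjacent located private_q)+

section \<open>Claims available to an unfed vertex\<close>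

lemma m_F: "q i j \<Longrightarrow> m (F i j) \<in> nbh (F i j) \<inter> S"
  by (simp add: in_nbh_iff m_in m_adj)

lemma poor_private:
  assumes "i = -1 \<and> \<bar>j\<bar> \<le> 1 \<or> j = -1 \<and> \<bar>i\<bar> \<le> 1" "card (nbh (F i j) \<inter> S) = 3"
  shows "poor (F i j)"
  unfolding poor_def using assms not_rich_private[OF assms(1)] not_q_nbr[of i j] by auto

lemma side_claim_private:
  assumes "q (-1) (-2)" "q 1 (-2)"
  shows "side_claim s (F 0 (-1))"
proof -
  have "\<not> q 0 (-2)" using assms nonadjacent by blast
  then have "nbh (F 0 (-1)) \<inter> S = {F (-1) (-2), F 1 (-2), F 0 0}"
    using assms by (auto simp: F_nbh Int_insert_Un not_q q_0_0)
  then have "poor (F 0 (-1))" by (intro poor_private) (simp_all add: F_eq)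
  moreover have "F 0 0 \<in> nbh (F 0 (-1))" "line (F 0 0) (F 0 (-1))"
    by (simp_all add: in_nbh_iff F_adj F_line)
  ultimately show ?thesis using unfed_s by (simp add: side_claim_def fr_0_0)
qed

lemma lone_claim_private:
  assumes "i = -1 \<and> \<bar>j\<bar> \<le> 1 \<or> j = -1 \<and> \<bar>i\<bar> \<le> 1"
    and "nbh (F i j) \<inter> S = {F 0 0, x, y}" "x \<noteq> y" "x \<noteq> F 0 0" "y \<noteq> F 0 0" "\<not> unfed x" "\<not> unfed y"
  shows "lone_claim s (F i j)"
proof -
  have "poor (F i j)" using assms by (intro poor_private) simp_all
  moreover have "F 0 0 \<in> nbh (F i j)" using assms(2) by blast
  ultimately show ?thesis using assms unfed_s by (auto simp: lone_claim_def fr_0_0)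
qed

lemma common_nbh:
  assumes "q 2 (-1)"
  shows "nbh (F 1 0) \<inter> S = {F 0 0, F 1 1, F 2 (-1)}"
  using assms by (auto simp: F_nbh Int_insert_Un not_q not_q_common_simps q_0_0 q_1_1)

lemma rich_common: "rich (F 1 0)"
  unfolding rich_def
  by (intro conjI bexI[of _ "F 0 0"] bexI[of _ "F 1 1"])
    (auto simp: in_nbh_iff F_adj q_0_0 q_1_1 not_q)

lemma m_end_notin:
  assumes "q 2 (-1)"
  shows "m (F 2 (-1)) \<noteq> F 0 0" "m (F 2 (-1)) \<noteq> F 1 1"
proof -
  have "m (m (F 2 (-1))) = F 2 (-1)" using m_m assms by blast
  moreover have "m (F 1 1) = F 0 0" using m_m[OF q_0_0] m_0_0 by simp
  ultimately show "m (F 2 (-1)) \<noteq> F 0 0" "m (F 2 (-1)) \<noteq> F 1 1"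
    using m_0_0 by (auto simp: F_eq)
qed

text \<open>The cell \<open>(1,0)\<close> sees only \<open>s\<close>, \<open>m s\<close> and
  \<open>(2,-1)\<close>. As the first two are matched to each other, it does not see the partner of
  \<open>(2,-1)\<close> and so feeds \<open>(2,-1)\<close>.\<close>

lemma not_unfed_end:
  assumes "q 2 (-1)"
  shows "\<not> unfed (F 2 (-1))"
proof -
  have "m (F 2 (-1)) \<notin> nbh (F 1 0)"
  proof
    assume "m (F 2 (-1)) \<in> nbh (F 1 0)"
    then have "m (F 2 (-1)) \<in> {F 0 0, F 1 1, F 2 (-1)}"
      using m_F[OF assms] common_nbh[OF assms] by blast
    then show False using m_end_notin[OF assms] m_F[OF assms] by auto
  qed
  then have "feeds (F 1 0) (F 2 (-1))"
    using rich_common by (simp add: feeds_def in_nbh_iff F_adj)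
  then show ?thesis by (rule not_unfed_if_feeds)
qed

text \<open>Both \<open>(-1,-1)\<close> and \<open>(1,-1)\<close> see \<open>s\<close>, the hub
  \<open>(0,-2)\<close> and one more element. Outside the \<open>twin\<close> case, at one of them
  neither of the other two elements is unfed, so \<open>s\<close> has a lone claim.\<close>

lemma hub_claim:
  assumes hub: "q 0 (-2)" "\<not> q (-2) 0"
    and Y: "q (-2) (-1) \<and> \<not> q (-2) (-2) \<or> q (-2) (-2) \<and> \<not> q (-2) (-1)"
    and X: "q 2 (-2) \<and> \<not> q 2 (-1) \<or> q 2 (-1) \<and> \<not> q 2 (-2)"
  shows "\<exists>u. side_claim s u \<or> lone_claim s u \<or> end_claim s u \<or> common_claim s u"
proof -
  have no: "\<not> q (-1) (-2)" "\<not> q 1 (-2)" using hub nonadjacent by blast+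
  have m8: "m (F 0 (-2)) = F (-1) (-3) \<or> m (F 0 (-2)) = F 0 (-3) \<or> m (F 0 (-2)) = F 1 (-3)"
    using m_F[OF hub(1)] no by (auto simp: F_nbh not_q)
  have qm8: "m (F 0 (-2)) \<in> S" and mm8: "m (m (F 0 (-2))) = F 0 (-2)"
    using hub m_in m_m by blast+
  have corner: "nbh (F (-1) (-1)) \<inter> S = {F 0 0, F 0 (-2), y}" if "q i j" "y = F i j"
    "i = -2 \<and> j = -1 \<or> i = -2 \<and> j = -2" for y i j
    using that hub Y by (auto simp: F_nbh Int_insert_Un not_q q_0_0 no)
  have "end": "nbh (F 1 (-1)) \<inter> S = {F 0 0, F 0 (-2), x}" if "q i j" "x = F i j"
    "i = 2 \<and> j = -1 \<or> i = 2 \<and> j = -2" for x i j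
    using that hub X by (auto simp: F_nbh Int_insert_Un not_q not_q_common_simps q_0_0 no)
  show ?thesis
  proof (cases "q 2 (-1)")
    case True
    note D = "end"[OF True refl]
    show ?thesis
    proof (cases "unfed (F 0 (-2))")
      case False
      have "lone_claim s (F 1 (-1))"
        by (rule lone_claim_private[OF _ D])
          (use False not_unfed_end[OF True] in \<open>simp_all add: F_eq\<close>)
      then show ?thesis by blast
    next
      case unfed8: True
      have "poor (F 1 (-1))" using D by (intro poor_private) (simp_all add: F_eq)
      then have twin: "twin s h k"
        using D frame m_s unfed_s unfed8 by (simp add: twin_def)
      have "m (F 0 (-2)) \<noteq> F 0 (-3)"
        using unfed_D(3)[OF unfed8] by (auto simp: F_line)
      then have "end_claim s (F 1 (-1)) \<or> common_claim s (F 1 0)"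
        using m8 twin unfolding end_claim_def common_claim_def by blast
      then show ?thesis by blast
    qed
  next
    case False
    then have q10: "q 2 (-2)" using X by blast
    note D = "end"[OF q10 refl]
    consider "m (F 0 (-2)) = F (-1) (-3)" | "m (F 0 (-2)) = F 0 (-3)" | "m (F 0 (-2)) = F 1 (-3)"
      using m8 by blast
    then show ?thesis
    proof cases
      case 1
      \<comment> \<open>Every neighbour of the hub outside \<open>S\<close> also sees
        \<open>s\<close>, \<open>(-1,-3)\<close> or \<open>(2,-2)\<close>.\<close>
      have "\<not> has_private (F 0 (-2))"
      proof
        assume "has_private (F 0 (-2))"
        then obtain u where u: "u \<notin> S" "nbh u \<inter> S = {F 0 (-2)}" unfolding has_private_def by blast
        then have "F 0 (-2) \<in> nbh u" by blast
        then have "u \<in> nbh (F 0 (-2))" by (simp add: in_nbh_iff king_adj_sym)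
        then have u8: "u \<in> {F (-1) (-3), F (-1) (-2), F (-1) (-1), F 0 (-3), F 0 (-1), F 1 (-3), F 1 (-2), F 1 (-1)}"
          by (simp add: F_nbh)
        have none: "F a b \<notin> nbh u" if "q a b" "\<not> (a = 0 \<and> b = -2)" for a b
        proof
          assume "F a b \<in> nbh u"
          then have "F a b = F 0 (-2)" using u(2) that(1) by blast
          then show False using that(2) by (simp add: F_eq)
        qed
        show False using u8 u(1) none[OF q10] none[of "-1" "-3"] none[OF q_0_0] qm8 1
          by (elim insertE emptyE) (simp_all add: in_nbh_iff F_adj)
      qed
      then have not8: "\<not> unfed (F 0 (-2))" using unfed_D(5) by blast
      show ?thesis
      proof (cases "q (-2) (-2)")
        case True
        have "m (F (-2) (-2)) \<noteq> F (-1) (-3)"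
          using mm8 1 m_m[OF True] by (auto simp: F_eq)
        then have "\<not> unfed (F (-2) (-2))"
          using True qm8 1 by (intro not_unfed_if_nbr[of _ "F (-1) (-3)"]) (auto simp: F_adj)
        then have "lone_claim s (F (-1) (-1))"
          by (intro lone_claim_private[OF _ corner[OF True refl]]) (use not8 in \<open>simp_all add: F_eq\<close>)
        then show ?thesis by blast
      next
        case False
        then have q5: "q (-2) (-1)" using Y by blast
        \<comment> \<open>The cell \<open>(-1,-2)\<close> sees the hub with its partner, but not the
          partner of \<open>(-2,-1)\<close>.\<close>
        have "m (F (-2) (-1)) \<notin> nbh (F (-1) (-2))"
          using m_F[OF q5] False no by (auto simp: F_nbh F_eq not_q)
        moreover have "rich (F (-1) (-2))"
          unfolding rich_def
          by (intro conjI bexI[of _ "F 0 (-2)"] bexI[of _ "F (-1) (-3)"])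
            (use hub qm8 1 no in \<open>auto simp: in_nbh_iff F_adj\<close>)
        ultimately have "feeds (F (-1) (-2)) (F (-2) (-1))"
          by (simp add: feeds_def in_nbh_iff F_adj)
        then have "\<not> unfed (F (-2) (-1))" by (rule not_unfed_if_feeds)
        then have "lone_claim s (F (-1) (-1))"
          by (intro lone_claim_private[OF _ corner[OF q5 refl]]) (use not8 in \<open>simp_all add: F_eq\<close>)
        then show ?thesis by blast
      qed
    next
      case 2
      \<comment> \<open>The hub is matched orthogonally. An unfed \<open>(2,-2)\<close> would be fed
        by \<open>(1,-2)\<close> or \<open>(1,-3)\<close>, depending on its partner.\<close>
      have not8: "\<not> unfed (F 0 (-2))"
        using unfed_D(3)[of "F 0 (-2)"] 2 by (auto simp: F_line)
      have "\<not> unfed (F 2 (-2))"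
      proof
        assume unfed10: "unfed (F 2 (-2))"
        have nf: "\<not> feeds u (F 2 (-2))" for u using unfed10 not_unfed_if_feeds by blast
        have m10: "m (F 2 (-2)) \<in> nbh (F 2 (-2)) \<inter> S" by (rule m_F[OF q10])
        show False
        proof (cases "m (F 2 (-2)) = F 1 (-3)")
          case True
          have "rich (F 1 (-2))"
            unfolding rich_def
            by (intro conjI bexI[of _ "F 0 (-2)"] bexI[of _ "F 0 (-3)"])
              (use hub qm8 2 no in \<open>auto simp: in_nbh_iff F_adj\<close>)
          then have "feeds (F 1 (-2)) (F 2 (-2))"
            unfolding feeds_def True
            by (intro conjI disjI2 bexI[of _ "F 0 (-2)"])
              (use hub in \<open>auto simp: in_nbh_iff F_adj F_eq\<close>)
          then show False using nf by blast
        next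
          case False
          have q13: "\<not> q 1 (-3)"
          proof
            assume "q 1 (-3)"
            then have "F 1 (-3) \<in> nbh (F 2 (-2)) \<inter> S" by (simp add: in_nbh_iff F_adj)
            then show False using False unfed_D(4)[OF unfed10] by auto
          qed
          have "rich (F 1 (-3))"
            unfolding rich_def
            by (intro conjI bexI[of _ "F 0 (-2)"] bexI[of _ "F 0 (-3)"])
              (use hub qm8 2 q13 in \<open>auto simp: in_nbh_iff F_adj\<close>)
          moreover have "\<not> line (F 2 (-2)) (m (F 2 (-2)))" using unfed_D(3)[OF unfed10] .
          then have "m (F 2 (-2)) \<notin> nbh (F 1 (-3))"
            using m10 q13 by (auto simp: F_nbh F_eq F_line not_q)
          ultimately have "feeds (F 1 (-3)) (F 2 (-2))"
            by (simp add: feeds_def in_nbh_iff F_adj)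
          then show False using nf by blast
        qed
      qed
      then have "lone_claim s (F 1 (-1))"
        by (intro lone_claim_private[OF _ D]) (use not8 in \<open>simp_all add: F_eq\<close>)
      then show ?thesis by blast
    next
      case 3
      \<comment> \<open>The cell \<open>(1,-2)\<close> sees the hub, its partner and
        \<open>(2,-2)\<close>, which is next to that partner. So the hub is fed, and
        \<open>(2,-2)\<close> has a neighbour other than its own partner.\<close>
      have "rich (F 1 (-2))"
        unfolding rich_def
        by (intro conjI bexI[of _ "F 0 (-2)"] bexI[of _ "F 1 (-3)"])
          (use hub qm8 3 no in \<open>auto simp: in_nbh_iff F_adj\<close>)
      then have "feeds (F 1 (-2)) (F 0 (-2))"
        unfolding feeds_def 3
        by (intro conjI disjI2 bexI[of _ "F 2 (-2)"]) (use q10 in \<open>auto simp: in_nbh_iff F_adj F_eq\<close>)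
      then have not8: "\<not> unfed (F 0 (-2))" by (rule not_unfed_if_feeds)
      have "m (F 2 (-2)) \<noteq> F 1 (-3)" using mm8 3 m_m[OF q10] by (auto simp: F_eq)
      then have "\<not> unfed (F 2 (-2))"
        using q10 qm8 3 by (intro not_unfed_if_nbr[of _ "F 1 (-3)"]) (auto simp: F_adj)
      then have "lone_claim s (F 1 (-1))"
        by (intro lone_claim_private[OF _ D]) (use not8 in \<open>simp_all add: F_eq\<close>)
      then show ?thesis by blast
    qed
  qed
qed

end

context lpds
begin

lemma unfed_claims:
  assumes "unfed s"
  shows "\<exists>u. side_claim s u \<or> lone_claim s u \<or> end_claim s u \<or> common_claim s u"
proof -
  obtain h k where f: "is_frame h k" and ms: "m s = fr s h k 1 1"
    using diagonal_frame[of s "m s"] unfed_D[OF assms] m_adj by blast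
  interpret A: lpds_frame S m s h k by unfold_locales (fact f assms ms)+
  interpret B: lpds_frame S m s k h
    by unfold_locales (simp_all add: is_frame_swap f assms ms fr_swap[of s k h])
  from A.frame_cases consider
    "A.q (-2) 1 \<and> A.q (-2) (-1)" | "A.q (-1) (-2) \<and> A.q 1 (-2)" |
    "A.q 0 (-2) \<and> \<not> A.q (-2) 0 \<and> (A.q (-2) (-1) \<and> \<not> A.q (-2) (-2) \<or> A.q (-2) (-2) \<and> \<not> A.q (-2) (-1)) \<and>
       (A.q 2 (-2) \<and> \<not> A.q 2 (-1) \<or> A.q 2 (-1) \<and> \<not> A.q 2 (-2))" |
    "A.q (-2) 0 \<and> \<not> A.q 0 (-2) \<and> (A.q (-1) (-2) \<and> \<not> A.q (-2) (-2) \<or> A.q (-2) (-2) \<and> \<not> A.q (-1) (-2)) \<and>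
       (A.q (-2) 2 \<and> \<not> A.q (-1) 2 \<or> A.q (-1) 2 \<and> \<not> A.q (-2) 2)"
    by blast
  then show ?thesis
  proof cases
    case 1
    then show ?thesis using B.side_claim_private by (auto simp: fr_swap[of s k h])
  next
    case 2
    then show ?thesis using A.side_claim_private by blast
  next
    case 3
    then show ?thesis using A.hub_claim by blast
  next
    case 4
    then show ?thesis using B.hub_claim unfolding fr_swap[of s k h] by blast
  qed
qed

end

section \<open>Slots are not shared\<close>

context lpds
begin

lemma twin_frame:
  assumes "twin s h k"
  shows "lpds_frame S m s h k"
  using assms by unfold_locales (simp_all add: twin_def)

section \<open>Claims at poor vertices do not collide\<close>

lemma card_poor: "poor u \<Longrightarrow> card (nbh u \<inter> S) = 3"
  by (simp add: poor_def)

lemma poor_nonadjacent: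
  assumes "poor u" "x \<in> nbh u \<inter> S" "y \<in> nbh u \<inter> S"
  shows "\<not> king_adj x y"
  using assms unfolding poor_def rich_def by blast

text \<open>Nonadjacent orthogonal neighbours of \<open>u\<close> lie on opposite sides of it, and
  every further neighbour of \<open>u\<close> touches one of them.\<close>

lemma two_sides_adjacent:
  assumes "s \<in> nbh u" "t \<in> nbh u" "r \<in> nbh u" "line s u" "line t u" "distinct [r, s, t]"
  shows "king_adj s t \<or> king_adj r s \<or> king_adj r t"
proof -
  have "king_adj u s" "line u s" using assms(1,4) by (auto simp: in_nbh_iff line_def)
  then obtain h k where f: "is_frame h k" and s: "s = fr u h k 1 0" using line_frame by blast
  have t: "t \<in> nbh (fr u h k 0 0)" and r: "r \<in> nbh (fr u h k 0 0)" and "line t (fr u h k 0 0)"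
    using assms by (simp_all add: fr_0_0)
  then have "t = fr u h k (-1) 0 \<or> king_adj s t"
    using assms(6) unfolding nbh_fr[OF f] s
    by (elim insertE emptyE) (simp_all add: fr_adj_iff[OF f] fr_line_iff[OF f])
  moreover have "king_adj r s \<or> king_adj r t" if "t = fr u h k (-1) 0"
    using r assms(6) unfolding nbh_fr[OF f] s that
    by (elim insertE emptyE) (simp_all add: fr_adj_iff[OF f])
  ultimately show ?thesis by blast
qed

lemma side_claim_unique:
  assumes "side_claim s u" "side_claim t u"
  shows "s = t"
proof (rule ccontr)
  assume ne: "s \<noteq> t"
  have u: "poor u" "s \<in> nbh u \<inter> S" "t \<in> nbh u \<inter> S" "line s u" "line t u"
    using assms unfed_D(1) by (auto simp: side_claim_def)
  have "\<not> nbh u \<inter> S \<subseteq> {s, t}"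
    using card_poor[OF u(1)] card_mono[of "{s, t}" "nbh u \<inter> S"] ne by auto
  then obtain r where r: "r \<in> nbh u \<inter> S" "r \<noteq> s" "r \<noteq> t" by blast
  have "king_adj s t \<or> king_adj r s \<or> king_adj r t"
    using two_sides_adjacent[of s u t r] u r ne by auto
  then show False using poor_nonadjacent[OF u(1)] u r by blast
qed

text \<open>The last fact separates end claims from side claims: the only orthogonal neighbour of
  \<open>u\<close> in \<open>S\<close> is \<open>(2,-1)\<close>, which is fed.\<close>

lemma end_claim_facts:
  assumes "end_claim s u"
  shows "unfed s" "poor u" "s \<in> nbh u" "\<not> line s u" "\<And>t. unfed t \<Longrightarrow> t \<in> nbh u \<Longrightarrow> \<not> line t u"
proof -
  obtain h k where tw: "twin s h k" and u: "u = fr s h k 1 (-1)"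
    using assms unfolding end_claim_def by blast
  interpret lpds_frame S m s h k using twin_frame[OF tw] .
  show "unfed s" "poor u" using tw u by (simp_all add: twin_def)
  have D: "nbh u \<inter> S = {F 0 0, F 0 (-2), F 2 (-1)}" using tw u by (simp add: twin_def)
  then show "s \<in> nbh u" by (auto simp: fr_0_0)
  have "\<not> line (F 0 0) u" by (simp add: u F_line)
  then show "\<not> line s u" by (simp add: fr_0_0)
  have "q 2 (-1)" using D by blast
  fix t assume t: "unfed t" "t \<in> nbh u"
  then have "t \<in> {F 0 0, F 0 (-2), F 2 (-1)}" using D unfed_D(1) by blast
  then show "\<not> line t u" using not_unfed_end[OF \<open>q 2 (-1)\<close>] t(1) by (auto simp: u F_line)
qed

lemma end_claim_unique:
  assumes "end_claim s u" "end_claim t u"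
  shows "s = t"
proof (rule ccontr)
  assume ne: "s \<noteq> t"
  obtain h k where tw: "twin s h k" and u: "u = fr s h k 1 (-1)"
    and cs: "m (fr s h k 0 (-2)) = fr s h k (-1) (-3) \<or>
      m (fr s h k 0 (-2)) = fr s h k 1 (-3) \<and> m (fr s h k 2 (-1)) = fr s h k 3 (-2)"
    using assms(1) unfolding end_claim_def by blast
  obtain h' k' where tw': "twin t h' k'" and u': "u = fr t h' k' 1 (-1)"
    and ct: "m (fr t h' k' 0 (-2)) = fr t h' k' (-1) (-3) \<or>
      m (fr t h' k' 0 (-2)) = fr t h' k' 1 (-3) \<and> m (fr t h' k' 2 (-1)) = fr t h' k' 3 (-2)"
    using assms(2) unfolding end_claim_def by blast
  interpret A: lpds_frame S m s h k using twin_frame[OF tw] .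
  interpret B: lpds_frame S m t h' k' using twin_frame[OF tw'] .
  have D: "nbh u \<inter> S = {A.F 0 0, A.F 0 (-2), A.F 2 (-1)}" using tw u by (simp add: twin_def)
  have D': "nbh u \<inter> S = {B.F 0 0, B.F 0 (-2), B.F 2 (-1)}" using tw' u' by (simp add: twin_def)
  have "A.q 2 (-1)" using D by blast
  note nu = A.not_unfed_end[OF this]
  have ut: "unfed (B.F 0 (-2))" "unfed (B.F 0 0)" using tw' by (simp_all add: twin_def fr_0_0)
  have t: "B.F 0 0 = A.F 0 (-2)"
  proof -
    have "B.F 0 0 \<in> {A.F 0 0, A.F 0 (-2), A.F 2 (-1)}" using D D' by blast
    moreover have "B.F 0 0 \<noteq> A.F 0 0" using ne by (simp add: fr_0_0)
    ultimately show ?thesis using nu ut(2) by auto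
  qed
  have s: "B.F 0 (-2) = A.F 0 0"
  proof -
    have "B.F 0 (-2) \<in> {A.F 0 0, A.F 0 (-2), A.F 2 (-1)}" using D D' by blast
    moreover have "B.F 0 (-2) \<noteq> A.F 0 (-2)" using B.F_eq[of t 0 "-2" 0 0] t by simp
    ultimately show ?thesis using nu ut(1) by auto
  qed
  have "fst k' = - fst k \<and> snd k' = - snd k" using t s by (auto simp: fr_def prod_eq_iff)
  moreover have "fst h' = fst h \<and> snd h' = snd h"
    using t u u' calculation by (auto simp: fr_def prod_eq_iff)
  \<comment> \<open>The frames are mirror images in the line through \<open>(1,-1)\<close> and
    \<open>(2,-1)\<close>. Both claims then need the second alternative, with contradictory partners
    \<open>(3,-2)\<close> and \<open>(3,0)\<close> of \<open>(2,-1)\<close>.\<close>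
  ultimately have BA: "B.F i j = A.F i (- 2 - j)" for i j
    using t by (auto simp: fr_def prod_eq_iff algebra_simps)
  have m8: "m (A.F 0 (-2)) = A.F 1 (-3)" using B.m_0_0 by (simp add: BA)
  then have "m (A.F 2 (-1)) = A.F 3 (-2)" using cs by (simp add: A.F_eq)
  moreover have "m (A.F 2 (-1)) = A.F 3 0" using ct A.m_0_0 by (simp add: BA A.F_eq)
  ultimately show False by (simp add: A.F_eq)
qed

definition claim :: "vtx \<Rightarrow> vtx \<Rightarrow> bool" where
  "claim s u \<longleftrightarrow> side_claim s u \<or> lone_claim s u \<or> end_claim s u"

lemma claim_facts:
  assumes "claim s u"
  shows "unfed s" "poor u" "s \<in> nbh u \<inter> S"
  using assms end_claim_facts(1-3)[of s u] unfed_D(1)[of s]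
  by (auto simp: claim_def side_claim_def lone_claim_def)

lemma claim_unique:
  assumes "claim s u" "claim t u"
  shows "s = t"
proof (rule ccontr)
  assume ne: "s \<noteq> t"
  note s = claim_facts[OF assms(1)] and t = claim_facts[OF assms(2)]
  have "\<not> lone_claim s u" using ne[symmetric] t(1,3) unfolding lone_claim_def by blast
  moreover have "\<not> lone_claim t u" using ne s(1,3) unfolding lone_claim_def by blast
  ultimately have "side_claim s u \<or> end_claim s u" "side_claim t u \<or> end_claim t u"
    using assms by (auto simp: claim_def)
  moreover have "\<not> (side_claim x u \<and> end_claim y u)" for x y
    using end_claim_facts(5)[of y u x] unfolding side_claim_def by blast
  ultimately show False using ne side_claim_unique end_claim_unique by blast
qed

lemma common_claim_facts:
  assumes "common_claim s u"
  shows "unfed s" "rich u" "s \<in> nbh u" "card (nbh u \<inter> S) = 3"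
proof -
  obtain h k where tw: "twin s h k" and u: "u = fr s h k 1 0"
    using assms unfolding common_claim_def by blast
  interpret lpds_frame S m s h k using twin_frame[OF tw] .
  have "q 2 (-1)" using tw by (auto simp: twin_def)
  show "unfed s" using tw by (simp add: twin_def)
  show "rich u" using rich_common u by simp
  have D: "nbh u \<inter> S = {F 0 0, F 1 1, F 2 (-1)}" using common_nbh[OF \<open>q 2 (-1)\<close>] u by simp
  then show "s \<in> nbh u" by (auto simp: fr_0_0)
  show "card (nbh u \<inter> S) = 3" using D by (simp add: F_eq)
qed

section \<open>Slots and their number at each vertex\<close>

lemma slot_cases:
  assumes "diagonal s" "has_private s"
  obtains "nbh s \<inter> S \<noteq> {m s}" "slot s = s"
  | "needy s" "feeds (slot s) s" "feeds (opposite s) s \<longrightarrow> slot s = opposite s"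
  | "claim s (slot s)"
  | "common_claim s (slot s)"
proof (cases "nbh s \<inter> S = {m s}")
  case False
  then show ?thesis using that(1) by (simp add: slot_def)
next
  case True
  then have needy: "needy s" using assms by (simp add: needy_def)
  show ?thesis
  proof (cases "\<exists>u. feeds u s")
    case fed: True
    then have "feeds (SOME u. feeds u s) s" by (rule someI_ex)
    then have "feeds (slot s) s" using True fed by (simp add: slot_def)
    moreover have "feeds (opposite s) s \<longrightarrow> slot s = opposite s" using True by (simp add: slot_def)
    ultimately show ?thesis using that(2) needy by blast
  next
    case False
    then have "unfed s" using needy by (simp add: unfed_def)
    from someI_ex[OF unfed_claims[OF this]]
    have "claim s (slot s) \<or> common_claim s (slot s)"
      using True False unfolding slot_def claim_def by auto
    then show ?thesis using that(3,4) by blast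
  qed
qed

lemma slot_in_cnbh:
  assumes "diagonal s" "has_private s"
  shows "slot s \<in> cnbh s"
  using assms
proof (cases rule: slot_cases)
  case 2
  then show ?thesis by (simp add: feeds_def cnbh_def)
next
  case 3
  then show ?thesis using claim_facts(3) by (auto simp: cnbh_def in_nbh_iff king_adj_sym)
next
  case 4
  then show ?thesis using common_claim_facts(3) by (auto simp: cnbh_def in_nbh_iff king_adj_sym)
qed (simp add: cnbh_def)

text \<open>Only \<open>m s\<close> and \<open>(2,-1)\<close> could compete for
  \<open>(1,0)\<close>. It does not feed \<open>m s\<close>, whose own common claim conflicts with
  the partner of \<open>(2,-1)\<close>; a diagonal \<open>(2,-1)\<close> takes its opposite vertex
  instead.\<close>

lemma common_claim_unique:
  assumes c: "common_claim s (slot s)"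
    and t: "diagonal t" "has_private t" "nbh t \<inter> S = {m t}" "slot t = slot s"
  shows "t = s"
proof -
  obtain h k where tw: "twin s h k" and u: "slot s = fr s h k 1 0"
    and m8: "m (fr s h k 0 (-2)) = fr s h k 1 (-3)" and m11: "m (fr s h k 2 (-1)) \<noteq> fr s h k 3 (-2)"
    using c unfolding common_claim_def by blast
  interpret A: lpds_frame S m s h k using twin_frame[OF tw] .
  have D5: "nbh (A.F 1 (-1)) \<inter> S = {A.F 0 0, A.F 0 (-2), A.F 2 (-1)}" using tw by (simp add: twin_def)
  then have q8: "A.q 0 (-2)" and q11: "A.q 2 (-1)" by blast+
  have outside: "\<not> A.q i j" if "A.F i j \<in> nbh (A.F 1 (-1))" "A.F i j \<notin> {A.F 0 0, A.F 0 (-2), A.F 2 (-1)}" for i j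
    using D5 that by blast
  have no: "\<not> A.q 1 (-2)" "\<not> A.q 2 (-2)"
    by (rule outside; simp add: in_nbh_iff A.F_adj A.F_eq)+
  have m11': "m (A.F 2 (-1)) = A.F 3 (-1) \<or> m (A.F 2 (-1)) = A.F 3 0"
    using A.m_F[OF q11] m11 no A.not_q A.not_q_common_simps by (auto simp: A.F_nbh)
  have D: "nbh (slot s) \<inter> S = {A.F 0 0, A.F 1 1, A.F 2 (-1)}" using A.common_nbh[OF q11] u by simp
  have rich: "rich (slot s)" using common_claim_facts(2)[OF c] .
  have choice: "feeds (slot s) t \<and> (feeds (opposite t) t \<longrightarrow> slot t = opposite t) \<or> common_claim t (slot s)"
    using t(1,2)
  proof (cases rule: slot_cases)
    case 3
    then show ?thesis using claim_facts(2) rich t(4) by (auto simp: poor_def)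
  qed (use t in auto)
  then have "t \<in> nbh (slot s)"
    using common_claim_facts(3)[of t "slot s"] by (auto simp: feeds_def in_nbh_iff king_adj_sym)
  moreover have "t \<in> S" using t(1) by (simp add: diagonal_def)
  ultimately have "t \<in> {A.F 0 0, A.F 1 1, A.F 2 (-1)}" using D by blast
  then consider "t = A.F 0 0" | "t = A.F 1 1" | "t = A.F 2 (-1)" by blast
  then show ?thesis
  proof cases
    case 1
    then show ?thesis by (simp add: fr_0_0)
  next
    case 2
    have mt: "m t = A.F 0 0" using 2 A.m_0_0 m_m[OF A.q_0_0] by simp
    have "\<not> feeds (slot s) t"
    proof
      assume f: "feeds (slot s) t"
      have "A.F 0 0 \<in> nbh (slot s)" using D by blast
      then obtain z where z: "z \<in> nbh (slot s) \<inter> S" "z \<noteq> A.F 1 1" "king_adj z (A.F 0 0)"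
        using f unfolding feeds_def mt unfolding 2 by blast
      then have "z \<in> {A.F 0 0, A.F 2 (-1)}" using D by blast
      then show False using z by (auto simp: A.F_adj)
    qed
    then have "common_claim t (slot s)" using choice by blast
    then obtain h' k' where tw': "twin t h' k'" and u': "slot s = fr t h' k' 1 0"
      unfolding common_claim_def by blast
    interpret B: lpds_frame S m t h' k' using twin_frame[OF tw'] .
    have "B.F 1 1 = A.F 0 0" "B.F 1 0 = A.F 1 0" "B.F 0 0 = A.F 1 1"
      using B.m_s mt u u' 2 by (simp_all add: fr_0_0)
    then have "fst h' = - fst k \<and> snd h' = - snd k" "fst k' = - fst h \<and> snd k' = - snd h"
      by (auto simp: fr_def prod_eq_iff)
    then have BA: "B.F i j = A.F (1 - j) (1 - i)" for i j
      using 2 by (simp add: fr_def algebra_simps)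
    \<comment> \<open>The reflection exchanging \<open>s\<close> and \<open>m s\<close> moves
      \<open>(1,-1)\<close> to \<open>(2,0)\<close>, which also sees the partner of
      \<open>(2,-1)\<close>.\<close>
    have D20: "nbh (A.F 2 0) \<inter> S = {A.F 1 1, A.F 3 1, A.F 2 (-1)}"
      using tw' by (simp add: twin_def BA)
    have "m (A.F 2 (-1)) \<in> nbh (A.F 2 0) \<inter> S"
      using m11' A.m_F[OF q11] by (auto simp: in_nbh_iff A.F_adj)
    then show ?thesis using D20 m11' by (auto simp: A.F_eq)
  next
    case 3
    have "\<not> common_claim t (slot s)"
      using common_claim_facts(1) A.not_unfed_end[OF q11] 3 by blast
    then have opp: "feeds (opposite t) t \<longrightarrow> slot t = opposite t" using choice by blast
    have mt: "m t = A.F 3 0" using m11' t(1) 3 by (auto simp: diagonal_def A.F_line)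
    have opp_eq: "opposite t = A.F 1 (-2)" unfolding opposite_def mt unfolding 3 by (simp add: fr_def)
    have q13: "A.q 1 (-3)" using m_in[OF q8] m8 by simp
    have "rich (A.F 1 (-2))"
      unfolding rich_def
      by (intro conjI bexI[of _ "A.F 0 (-2)"] bexI[of _ "A.F 1 (-3)"])
        (use q8 q13 no in \<open>auto simp: in_nbh_iff A.F_adj\<close>)
    then have "feeds (opposite t) t"
      unfolding feeds_def opp_eq mt unfolding 3 by (simp add: in_nbh_iff A.F_adj)
    then have "A.F 1 0 = A.F 1 (-2)" using opp opp_eq t(4) u by simp
    then show ?thesis by (simp add: A.F_eq)
  qed
qed

text \<open>A vertex of \<open>S\<close> serves only itself. Any other vertex serves one claim, one
  common claim, or fed elements bounded by \<open>card_fed_le\<close>.\<close>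

lemma card_slot_le:
  "card {s. diagonal s \<and> has_private s \<and> slot s = u} \<le> card (cnbh u \<inter> S) - 2" (is "card ?K \<le> _")
proof (cases "u \<in> S")
  case True
  have K: "nbh s \<inter> S \<noteq> {m s} \<and> s = u" if "s \<in> ?K" for s
  proof -
    have "diagonal s" "has_private s" "slot s = u" using that by auto
    then show ?thesis
    proof (cases rule: slot_cases)
      case 2
      then show ?thesis using True \<open>slot s = u\<close> by (auto simp: feeds_def rich_def)
    next
      case 3
      then show ?thesis using True \<open>slot s = u\<close> claim_facts(2) by (auto simp: poor_def)
    next
      case 4
      then show ?thesis using True \<open>slot s = u\<close> common_claim_facts(2) by (auto simp: rich_def)
    qed auto
  qed
  show ?thesis
  proof (cases "?K = {}")
    case True
    then show ?thesis by (simp only: card.empty)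
  next
    case False
    then obtain s where "s \<in> ?K" by blast
    then have "nbh u \<inter> S \<noteq> {m u}" using K by metis
    moreover have "m u \<in> nbh u \<inter> S" using True m_in m_adj by (simp add: in_nbh_iff)
    ultimately obtain z where z: "z \<in> nbh u \<inter> S" "z \<noteq> m u" by blast
    have "card {u, m u, z} \<le> card (cnbh u \<inter> S)"
      using True z \<open>m u \<in> nbh u \<inter> S\<close> by (intro card_mono) (auto simp: cnbh_def)
    moreover have "u \<noteq> m u" "u \<noteq> z" using z \<open>m u \<in> nbh u \<inter> S\<close> self_notin_nbh by auto
    ultimately have "3 \<le> card (cnbh u \<inter> S)" using z by simp
    moreover have "card ?K \<le> card {u}" using K by (intro card_mono) auto
    ultimately show ?thesis by simp
  qed
next
  case False
  have cn: "cnbh u \<inter> S = nbh u \<inter> S" using False by (rule cnbh_Int_notin)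
  have K: "nbh s \<inter> S = {m s}" if "s \<in> ?K" for s
  proof (rule ccontr)
    assume "nbh s \<inter> S \<noteq> {m s}"
    then have "slot s = s" by (simp add: slot_def)
    then show False using that False by (auto simp: diagonal_def)
  qed
  have alt: "needy s \<and> feeds u s \<or> claim s u \<or> common_claim s u" if "s \<in> ?K" for s
  proof -
    have "diagonal s" "has_private s" "slot s = u" using that by auto
    then show ?thesis by (cases rule: slot_cases) (use K[OF that] in auto)
  qed
  consider "?K = {}" | s where "s \<in> ?K" "common_claim s u" | s where "s \<in> ?K" "claim s u"
    | "\<And>s. s \<in> ?K \<Longrightarrow> needy s \<and> feeds u s" "?K \<noteq> {}"
    using alt by blast
  then show ?thesis
  proof cases
    case 1
    then show ?thesis by (simp only: card.empty)
  next
    case (2 s)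
    have "?K \<subseteq> {s}"
    proof
      fix t assume "t \<in> ?K"
      then have "t = s" using 2 K common_claim_unique[of s t] by auto
      then show "t \<in> {s}" by simp
    qed
    then have "card ?K \<le> 1" using card_mono[of "{s}" ?K] by simp
    then show ?thesis using common_claim_facts(4)[OF 2(2)] cn by simp
  next
    case (3 s)
    have poor: "poor u" using claim_facts(2)[OF 3(2)] .
    then have "\<not> rich u" by (simp add: poor_def)
    then have "claim t u" if "t \<in> ?K" for t
      using alt[OF that] common_claim_facts(2)[of t u] by (auto simp: feeds_def)
    then have "?K \<subseteq> {s}" using claim_unique 3(2) by blast
    then have "card ?K \<le> 1" using card_mono[of "{s}" ?K] by simp
    then show ?thesis using card_poor[OF poor] cn by simp
  next
    case 4
    then obtain s where "feeds u s" by blast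
    then have "rich u" by (simp add: feeds_def)
    from card_fed_le[OF this] have le: "card {s. needy s \<and> feeds u s} + 2 \<le> card (nbh u \<inter> S)" .
    have "{s. needy s \<and> feeds u s} \<subseteq> nbh u"
      by (auto simp: feeds_def in_nbh_iff king_adj_sym)
    then have "finite {s. needy s \<and> feeds u s}" using finite_nbh finite_subset by blast
    moreover have "?K \<subseteq> {s. needy s \<and> feeds u s}" using 4(1) by blast
    ultimately have "card ?K \<le> card {s. needy s \<and> feeds u s}" by (intro card_mono)
    then show ?thesis using le cn by simp
  qed
qed

text \<open>Diagonal elements with a private vertex are counted by slots, the others by the surplus
  of \<open>S\<close> over its elements with private vertices. Slots lie within distance 1, hence
  the radii.\<close>

lemma box_bound:
  "2 * card (box k) + card {s \<in> box (k - 1). diagonal s} \<le> 10 * card (S \<inter> box (k + 1))"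
proof -
  let ?c = "\<lambda>u. card (cnbh u \<inter> S)" and ?B = "box k" and ?T = "S \<inter> box (k + 1)"
  let ?Q = "{s \<in> box (k - 1). diagonal s}"
  \<comment> \<open>The subtraction is truncated: for \<open>c u = 1\<close> both sides are
    2.\<close>
  have "2 + (?c u - 2) = ?c u + of_bool (?c u = 1)" for u
    using card_cnbh_pos[of u] by (auto simp: of_bool_def)
  then have "(\<Sum>u \<in> ?B. 2 + (?c u - 2)) = (\<Sum>u \<in> ?B. ?c u + of_bool (?c u = 1))" by simp
  then have total: "2 * card ?B + (\<Sum>u \<in> ?B. ?c u - 2) = (\<Sum>u \<in> ?B. ?c u) + card {u \<in> ?B. ?c u = 1}"
    unfolding sum.distrib by (simp add: Collect_conj_eq)
  have "{s \<in> ?Q. has_private s} \<subseteq> (\<Union>u \<in> ?B. {s. diagonal s \<and> has_private s \<and> slot s = u})"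
  proof
    fix s assume s: "s \<in> {s \<in> ?Q. has_private s}"
    then have "slot s \<in> cnbh s" using slot_in_cnbh by simp
    then have "slot s \<in> box (k - 1 + 1)" using cnbh_subset_box[of s "k - 1"] s by blast
    then show "s \<in> (\<Union>u \<in> ?B. {s. diagonal s \<and> has_private s \<and> slot s = u})" using s by simp
  qed
  moreover have "finite {s. diagonal s \<and> has_private s \<and> slot s = u}" for u
  proof (rule finite_subset)
    show "{s. diagonal s \<and> has_private s \<and> slot s = u} \<subseteq> cnbh u"
      using slot_in_cnbh in_cnbh_sym by blast
  qed simp
  ultimately have "card {s \<in> ?Q. has_private s} \<le> card (\<Union>u \<in> ?B. {s. diagonal s \<and> has_private s \<and> slot s = u})"
    by (intro card_mono) auto
  also have "\<dots> \<le> (\<Sum>u \<in> ?B. card {s. diagonal s \<and> has_private s \<and> slot s = u})"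
    by (rule card_UN_le) simp
  also have "\<dots> \<le> (\<Sum>u \<in> ?B. ?c u - 2)" by (rule sum_mono) (rule card_slot_le)
  finally have fed: "card {s \<in> ?Q. has_private s} \<le> (\<Sum>u \<in> ?B. ?c u - 2)" .
  have split: "card A = card {s \<in> A. has_private s} + card {s \<in> A. \<not> has_private s}" if "finite A" for A
  proof -
    have "A = {s \<in> A. has_private s} \<union> {s \<in> A. \<not> has_private s}" by blast
    then show ?thesis using that card_Un_disjoint[of "{s \<in> A. has_private s}" "{s \<in> A. \<not> has_private s}"]
      by fastforce
  qed
  have "card {s \<in> ?Q. \<not> has_private s} \<le> card {s \<in> ?T. \<not> has_private s}"
    by (intro card_mono) (auto simp: diagonal_def box_def)
  then show ?thesis
    using total fed split[of ?Q] split[of ?T] sum_coverage_le[of k] card_singly_covered_le[of k] by simp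
qed

end

section \<open>Densities\<close>

lemma partner_props:
  assumes "perfect_matching S M" "v \<in> S"
  shows "partner M v \<in> S" "king_adj v (partner M v)" "partner M (partner M v) = v"
proof -
  have edges: "M \<subseteq> {{a, b} | a b. a \<in> S \<and> b \<in> S \<and> king_adj a b}"
    and uniq: "\<And>v. v \<in> S \<Longrightarrow> \<exists>!e. e \<in> M \<and> v \<in> e"
    using assms(1) unfolding perfect_matching_def by blast+
  have edge: "\<exists>w. w \<in> S \<and> king_adj v w \<and> e = {v, w}" if e: "e \<in> M" "v \<in> e" for v e
  proof -
    obtain a b where ab: "e = {a, b}" "a \<in> S" "b \<in> S" "king_adj a b" using e(1) edges by blast
    then show ?thesis using e(2) king_adj_sym[of a b] by (auto simp: doubleton_eq_iff)
  qed
  have partner_eq: "partner M v = w" if w: "{v, w} \<in> M" "w \<noteq> v" "v \<in> S" for v w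
    unfolding partner_def
  proof (rule the_equality)
    fix x assume x: "{v, x} \<in> M \<and> x \<noteq> v"
    then have "{v, x} = {v, w}" using uniq[OF w(3)] w(1) by blast
    then show "x = w" using x by (auto simp: doubleton_eq_iff)
  qed (use w in simp)
  obtain e where "e \<in> M" "v \<in> e" using uniq[OF assms(2)] by blast
  then obtain w where w: "w \<in> S" "king_adj v w" "{v, w} \<in> M" using edge[of e v] by blast
  have "v \<noteq> w" using w(2) by (simp add: king_adj_iff)
  then have p: "partner M v = w" "partner M w = v"
    using partner_eq[of v w] partner_eq[of w v] w assms(2) by (auto simp: insert_commute)
  show "partner M v \<in> S" "king_adj v (partner M v)" "partner M (partner M v) = v"
    using w p by simp_all
qed

lemma lpds_partner:
  assumes "is_LPDS S" "perfect_matching S M"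
  shows "lpds S (partner M)"
proof
  show "cnbh v \<inter> S \<noteq> {}" for v using assms(1) by (simp add: is_LPDS_def)
  show "u = v" if "u \<notin> S" "v \<notin> S" "nbh u \<inter> S = nbh v \<inter> S" for u v
    using assms(1) that unfolding is_LPDS_def by blast
qed (use partner_props[OF assms(2)] in auto)

lemma card_Int_box_Suc_le: "card (A \<inter> box (int k + 1)) \<le> card (A \<inter> box (int k)) + (8 * k + 8)"
proof -
  have sub: "box (int k) \<subseteq> box (int (Suc k))" by (auto simp: box_def)
  have "card (A \<inter> box (int (Suc k))) \<le> card ((A \<inter> box (int k)) \<union> (box (int (Suc k)) - box (int k)))"
    by (intro card_mono) auto
  also have "\<dots> \<le> card (A \<inter> box (int k)) + card (box (int (Suc k)) - box (int k))"
    by (rule card_Un_le)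
  also have "card (box (int (Suc k)) - box (int k)) = card (box (int (Suc k))) - card (box (int k))"
    using sub by (intro card_Diff_subset) auto
  also have "\<dots> = 8 * k + 8" unfolding card_box by (simp add: power2_eq_square algebra_simps)
  finally show ?thesis by (simp add: add.commute)
qed

lemma density_eventually_less:
  assumes "density A \<le> ereal a" "e > 0"
  shows "eventually (\<lambda>k. real (card (A \<inter> box (int k))) < (a + e) * real (card (box (int k)))) sequentially"
proof -
  have "density A < ereal (a + e)" using assms by (intro order.strict_trans1[OF assms(1)]) simp
  then have "eventually (\<lambda>k. ereal (real (card (A \<inter> ball_k k (0, 0))) / real (card (ball_k k (0, 0))))
      < ereal (a + e)) sequentially"
    unfolding density_def by (rule Limsup_lessD)
  then show ?thesis
  proof (rule eventually_mono)
    fix k assume "ereal (real (card (A \<inter> ball_k k (0, 0))) / real (card (ball_k k (0, 0)))) < ereal (a + e)"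
    then show "real (card (A \<inter> box (int k))) < (a + e) * real (card (box (int k)))"
      by (simp add: ball_k_eq_box card_box divide_less_eq)
  qed
qed

text \<open>The ratios lie in \<open>[0, 1]\<close>, so the argument can proceed with real
  numbers.\<close>

lemma density_real:
  obtains a where "density A = ereal a"
proof -
  have le: "card (A \<inter> ball_k k (0, 0)) \<le> card (ball_k k (0, 0))" for k
    by (intro card_mono) (auto simp: ball_k_eq_box)
  have "density A \<le> 1"
    unfolding density_def
  proof (rule Limsup_bounded, rule always_eventually, rule allI)
    fix k
    show "ereal (real (card (A \<inter> ball_k k (0, 0))) / real (card (ball_k k (0, 0)))) \<le> 1"
      using le[of k] by (auto simp: divide_le_eq_1)
  qed
  moreover have "0 \<le> density A"
    unfolding density_def by (rule le_Limsup) (auto intro: always_eventually)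
  ultimately show ?thesis using that by (cases "density A") auto
qed

theorem theorem2:
  fixes S :: "vtx set" and M :: "vtx set set"
  assumes "is_LPDS S"
    and "perfect_matching S M"
  shows "ereal (9/2) * density {v \<in> S. card (nbh v \<inter> nbh (partner M v)) = 2}
         + ereal 5 * density {v \<in> S. card (nbh v \<inter> nbh (partner M v)) = 4} \<ge> 1"
proof -
  interpret lpds S "partner M" using lpds_partner[OF assms] .
  let ?S1 = "{v \<in> S. card (nbh v \<inter> nbh (partner M v)) = 2}"
  let ?S2 = "{v \<in> S. card (nbh v \<inter> nbh (partner M v)) = 4}"
  have S1: "?S1 = {v. diagonal v}" and S2: "?S2 = S - {v. diagonal v}"
    using card_common_nbh[OF m_adj] by (auto simp: diagonal_def split: if_splits)
  obtain a where a: "density ?S1 = ereal a" by (rule density_real)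
  obtain b where b: "density ?S2 = ereal b" by (rule density_real)
  have "1 \<le> 9/2 * a + 5 * b"
  proof (rule ccontr)
    assume "\<not> 1 \<le> 9/2 * a + 5 * b"
    \<comment> \<open>Thus \<open>9 * a + 10 * b = 2 - 40 * e\<close>. Slack \<open>e\<close> in
      both densities costs \<open>19 * e\<close>, leaving \<open>21 * e\<close> against the boundary
      terms.\<close>
    define e where "e = (1 - (9/2 * a + 5 * b)) / 20"
    have e: "e > 0" using \<open>\<not> _\<close> by (simp add: e_def)
    \<comment> \<open>One layer costs \<open>8 * k\<close> for \<open>?S1\<close> and
      \<open>10 * (8 * k + 8)\<close> for \<open>S\<close>.\<close>
    have bound: "2 * real (card (box (int k))) \<le>
        9 * real (card (?S1 \<inter> box (int k))) + 10 * real (card (?S2 \<inter> box (int k))) + (88 * real k + 80)"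
      if "k \<ge> 1" for k
    proof -
      have "card (?S1 \<inter> box (int k)) \<le> card (?S1 \<inter> box (int k - 1)) + 8 * k"
        using card_Int_box_Suc_le[of ?S1 "k - 1"] that by (simp add: of_nat_diff algebra_simps)
      moreover have "{s \<in> box (int k - 1). diagonal s} = ?S1 \<inter> box (int k - 1)" using S1 by auto
      moreover have "card (S \<inter> box (int k)) = card (?S1 \<inter> box (int k)) + card (?S2 \<inter> box (int k))"
      proof -
        have "S \<inter> box (int k) = (?S1 \<inter> box (int k)) \<union> (?S2 \<inter> box (int k))"
          unfolding S1 S2 by (auto simp: diagonal_def)
        moreover have "(?S1 \<inter> box (int k)) \<inter> (?S2 \<inter> box (int k)) = {}" by auto
        ultimately show ?thesis using card_Un_disjoint[of "?S1 \<inter> box (int k)" "?S2 \<inter> box (int k)"] by simp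
      qed
      ultimately have "2 * card (box (int k)) \<le>
        9 * card (?S1 \<inter> box (int k)) + 10 * card (?S2 \<inter> box (int k)) + (88 * k + 80)"
        using box_bound[of "int k"] card_Int_box_Suc_le[of S k] by simp
      then show ?thesis by linarith
    qed
    \<comment> \<open>For \<open>k \<ge> K\<close> the boundary term is at most
      \<open>2 * 88 * k \<le> 2 * e * N\<close>, because \<open>N \<ge> k * k\<close>.\<close>
    obtain K where K: "real K > 88 / e" using reals_Archimedean2 by blast
    have "eventually (\<lambda>k. real (card (?S1 \<inter> box (int k))) < (a + e) * real (card (box (int k))) \<and>
        real (card (?S2 \<inter> box (int k))) < (b + e) * real (card (box (int k))) \<and> k \<ge> max 1 K) sequentially"
      using density_eventually_less[of ?S1 a e] density_eventually_less[of ?S2 b e] a b e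
      by (intro eventually_conj eventually_ge_at_top) simp_all
    then obtain k where k: "real (card (?S1 \<inter> box (int k))) < (a + e) * real (card (box (int k)))"
      "real (card (?S2 \<inter> box (int k))) < (b + e) * real (card (box (int k)))" "k \<ge> 1" "k \<ge> K"
      using eventually_happens by fastforce
    define N where "N = real (card (box (int k)))"
    have N: "N = (2 * real k + 1)\<^sup>2" by (simp add: N_def card_box)
    have "2 * N < 9 * ((a + e) * N) + 10 * ((b + e) * N) + (88 * real k + 80)"
      using bound[OF k(3)] k(1,2) unfolding N_def by linarith
    also have "\<dots> = (9 * a + 10 * b + 19 * e) * N + (88 * real k + 80)" by (simp add: algebra_simps)
    also have "9 * a + 10 * b + 19 * e = 2 - 21 * e" by (simp add: e_def field_simps)
    finally have "21 * e * N < 88 * real k + 80" by (simp add: algebra_simps)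
    moreover have "88 * real k \<le> e * N"
    proof -
      have "88 / e \<le> real k" using K k(4) by linarith
      then have "88 \<le> e * real k" using e by (simp add: divide_le_eq mult.commute)
      then have "88 * real k \<le> (e * real k) * real k" by (intro mult_right_mono) simp_all
      also have "\<dots> = e * (real k * real k)" by simp
      also have "real k * real k \<le> N" unfolding N by (simp add: power2_eq_square algebra_simps)
      finally show ?thesis using e by (simp add: mult_left_mono)
    qed
    moreover have "e * N > 0" using e N by simp
    moreover have "88 * real k \<ge> 80" using k(3) by linarith
    ultimately show False by linarith
  qed
  then have "ereal 1 \<le> ereal (9/2 * a + 5 * b)" by simp
  then show ?thesis unfolding a b by (simp add: one_ereal_def)
qed

end
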